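(* Let $(\Omega,\mathcal{F},\mathbb{P},\sigma)$ be an ergodic probability measure-preserving dynamical system and let $F\in\widetilde{\mathcal{E}}(\Omega)$ be an integrable random lift of the generator of a random circle endomorphism over $(\Omega,\mathcal{F},\mathbb{P},\sigma)$, with lower and upper maps $F_L,F_U$. Let $I=[a,b]\subset[\rho(F_L),\rho(F_U)]$. Then there exists a full-measure set $\Omega_I\subset\Omega$ such that, for a.e. $\omega\in\Omega_I$, there exists $x_I(\omega)\in\mathbb{R}$ such that $$\operatorname{Clust}\left\{\frac{F^{(n)}_\omega(x_I(\omega))-x_I(\omega)}{n}:n\ge1\right\}=I,$$ where $\operatorname{Clust}\{u_n:n\ge1\}$ denotes the set of all limits of subsequences of $(u_n)$.
   Context: $\mathbb{S}^1=\mathbb{R}/\mathbb{Z}$, $\pi:\mathbb{R}\to\mathbb{S}^1$ is the projection. $\mathrm{End}_1(\mathbb{S}^1)$ is the set of continuous degree-one circle maps; $\mathrm{End}_1(\mathbb{R})$ is the set of continuous $F:\mathbb{R}\to\mathbb{R}$ with $F(x+1)=F(x)+1$ for all $x$; $\mathrm{Mon}_1(\mathbb{R})$ is the set of non-decreasing elements of $\mathrm{End}_1(\mathbb{R})$. A random circle endomorphism over $(\Omega,\mathcal{F},\mathbb{P},\sigma)$ is given by a generator, i.e. a measurable map $f:\Omega\to\mathrm{End}_1(\mathbb{S}^1)$, $\omega\mapsto f_\omega$, through the cocycle $f^{(n)}_\omega=f_{\sigma^{n-1}\omega}\circ\cdots\circ f_\omega$. A random lift of $f$ is a measurable map $F:\Omega\to\mathrm{End}_1(\mathbb{R})$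 with $\pi\circ F_\omega=f_\omega\circ\pi$ for every $\omega$; its cocycle is $F^{(n)}_\omega=F_{\sigma^{n-1}\omega}\circ\cdots\circ F_\omega$. $\widetilde{\mathcal{E}}(\Omega)$ is the set of measurable $F:\Omega\to\mathrm{End}_1(\mathbb{R})$ with $\int_\Omega\|F_\omega-\mathrm{Id}\|\,\mathrm{d}\mathbb{P}(\omega)<\infty$, where $\|\cdot\|$ is the sup norm; $\widetilde{\mathcal{M}}(\Omega)$ is the subset of those $F$ with values in $\mathrm{Mon}_1(\mathbb{R})$. Lower and upper maps: $F_{\omega,L}(x)=\inf_{y\ge x}F_\omega(y)$, $F_{\omega,U}(x)=\sup_{y\le x}F_\omega(y)$; both $F_L,F_U$ belong to $\widetilde{\mathcal{M}}(\Omega)$. For $G\in\widetilde{\mathcal{M}}(\Omega)$, by a known result (Li–Lu) there is an integrable function $\rho_G$, the random rotation number, such that for any $x\in\mathbb{R}$, $\lim_{n\to\infty}(G^{(n)}_\omega(x)-x)/n=\rho_G(\omega)$ for a.e. $\omega$; $\rho(G)=\int_\Omega\rho_G\,\mathrm{d}\mathbb{P}$ is its mean (for ergodic $\sigma$, $\rho_G=\rho(G)$ a.e.). The notation $I=[a,b]$ means a closed interval with $a\le b$. *)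

theory Defs
  imports "HOL-Probability.Probability"
begin

section \<open>The circle as the quotient of the reals by the integers\<close>

quotient_type circle = real / "\<lambda>x y::real. x - y \<in> \<int>"
  morphisms rep_circle circle_proj
proof (rule equivpI)
  show "reflp (\<lambda>x y::real. x - y \<in> \<int>)"
    by (simp add: reflp_def)
  show "symp (\<lambda>x y::real. x - y \<in> \<int>)"
    unfolding symp_def by (metis Ints_minus minus_diff_eq)
  show "transp (\<lambda>x y::real. x - y \<in> \<int>)"
    unfolding transp_def by (metis Ints_add diff_add_cancel add_diff_eq)
qed

lemma circle_proj_eq_iff: "circle_proj x = circle_proj y \<longleftrightarrow> x - y \<in> \<int>"
  by (rule circle.abs_eq_iff)

lemma circle_proj_surj: "\<exists>x. circle_proj x = p"
  by (metis Quotient_abs_rep[OF Quotient_circle])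

text \<open>The metric is the quotient metric: the distance of the two fibres in the real line.\<close>

instantiation circle :: metric_space
begin

definition dist_circle :: "circle \<Rightarrow> circle \<Rightarrow> real" where
  "dist_circle p q = setdist (circle_proj -` {p}) (circle_proj -` {q})"

definition uniformity_circle :: "(circle \<times> circle) filter" where
  "uniformity_circle = (INF e\<in>{0 <..}. principal {(x, y). dist x y < e})"

definition open_circle :: "circle set \<Rightarrow> bool" where
  "open_circle U \<longleftrightarrow> (\<forall>x\<in>U. \<forall>\<^sub>F (x', y) in uniformity. x' = x \<longrightarrow> y \<in> U)"

lemma dist_circle_proj:
  "dist (circle_proj x) (circle_proj y) = \<bar>(x - y) - of_int (round (x - y))\<bar>"
proof -
  let ?A = "circle_proj -` {circle_proj x}" and ?B = "circle_proj -` {circle_proj y}"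
  let ?c = "\<bar>(x - y) - of_int (round (x - y))\<bar>"
  have "setdist ?A ?B \<le> dist x (y + of_int (round (x - y)))"
    by (rule setdist_le_dist) (auto simp: circle_proj_eq_iff)
  then have 1: "setdist ?A ?B \<le> ?c"
    by (simp add: dist_real_def algebra_simps)
  have 2: "?c \<le> dist u v" if "u \<in> ?A" "v \<in> ?B" for u v
  proof -
    from that obtain m n where "u - x = of_int m" "v - y = of_int n"
      by (auto simp: circle_proj_eq_iff elim!: Ints_cases)
    then have "dist u v = \<bar>(x - y) - of_int (n - m)\<bar>"
      by (simp add: dist_real_def algebra_simps)
    then show ?thesis using round_diff_minimal[of "x - y" "n - m"] by simp
  qed
  have "?c \<le> setdist ?A ?B"
    by (rule le_setdistI) (use 2 in auto)
  with 1 show ?thesis unfolding dist_circle_def by linarith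
qed

instance
proof
  show "uniformity = (INF e\<in>{0 <..}. principal {(x, y :: circle). dist x y < e})"
    by (rule uniformity_circle_def)
  show "open U \<longleftrightarrow> (\<forall>x\<in>U. \<forall>\<^sub>F (x', y) in uniformity. x' = x \<longrightarrow> y \<in> U)" for U :: "circle set"
    by (rule open_circle_def)
next
  fix p q r :: circle
  obtain x y z where p: "p = circle_proj x" and q: "q = circle_proj y" and r: "r = circle_proj z"
    by (metis circle_proj_surj)
  show "dist p q = 0 \<longleftrightarrow> p = q"
  proof
    assume "dist p q = 0"
    then have "x - y = of_int (round (x - y))"
      unfolding p q dist_circle_proj by simp
    then show "p = q" unfolding p q circle_proj_eq_iff by (metis Ints_of_int)
  next
    assume "p = q"
    then show "dist p q = 0" using dist_circle_proj[of x x] p by simp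
  qed
  show "dist p q \<le> dist p r + dist q r"
    using round_diff_minimal[of "x - y" "round (x - z) - round (y - z)"]
    unfolding p q r dist_circle_proj by simp
qed

end


section \<open>Degree-one endomorphisms\<close>

definition End1_real :: "(real \<Rightarrow> real) set" where
  "End1_real = {F. continuous_on UNIV F \<and> (\<forall>x. F (x + 1) = F x + 1)}"

text \<open>A continuous circle map has degree one when it lifts to a continuous map that
  commutes with the translation by 1.\<close>

definition End1_circle :: "(circle \<Rightarrow> circle) set" where
  "End1_circle = {f. continuous_on UNIV f \<and> (\<exists>F\<in>End1_real. circle_proj \<circ> F = f \<circ> circle_proj)}"

text \<open>The supremum below is over a bounded set whenever both maps lie in \<^term>\<open>End1_real\<close>,
  or both are circle maps.\<close>

definition sup_dist :: "('b \<Rightarrow> 'c::metric_space) \<Rightarrow> ('b \<Rightarrow> 'c) \<Rightarrow> real" where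
  "sup_dist f g = (SUP x. dist (f x) (g x))"

text \<open>Borel sigma-algebra of the uniform topology on a set \<open>E\<close> of maps.\<close>

definition uniform_borel :: "('b \<Rightarrow> 'c::metric_space) set \<Rightarrow> ('b \<Rightarrow> 'c) measure" where
  "uniform_borel E =
     sigma E {U. U \<subseteq> E \<and> (\<forall>f\<in>U. \<exists>e>0. \<forall>g\<in>E. sup_dist f g < e \<longrightarrow> g \<in> U)}"


section \<open>Ergodic systems, random maps and their lifts\<close>

locale ergodic_system = prob_space M for M :: "'a measure" +
  fixes \<sigma> :: "'a \<Rightarrow> 'a"
  assumes measurable_shift: "\<sigma> \<in> M \<rightarrow>\<^sub>M M"
    and measure_preserving: "distr M M \<sigma> = M"
    and ergodic: "\<And>A. A \<in> sets M \<Longrightarrow> \<sigma> -` A \<inter> space M = A \<Longrightarrow> prob A = 0 \<or> prob A = 1"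

primrec cocycle :: "('a \<Rightarrow> 'a) \<Rightarrow> ('a \<Rightarrow> 'b \<Rightarrow> 'b) \<Rightarrow> nat \<Rightarrow> 'a \<Rightarrow> 'b \<Rightarrow> 'b" where
  "cocycle \<sigma> f 0 \<omega> = id"
| "cocycle \<sigma> f (Suc n) \<omega> = f ((\<sigma> ^^ n) \<omega>) \<circ> cocycle \<sigma> f n \<omega>"

text \<open>The generator \<open>f\<close> defines the random circle endomorphism \<^term>\<open>cocycle \<sigma> f\<close>.\<close>

definition circle_generator :: "'a measure \<Rightarrow> ('a \<Rightarrow> circle \<Rightarrow> circle) \<Rightarrow> bool" where
  "circle_generator M f \<longleftrightarrow> f \<in> M \<rightarrow>\<^sub>M uniform_borel End1_circle"

definition random_lift ::
    "'a measure \<Rightarrow> ('a \<Rightarrow> circle \<Rightarrow> circle) \<Rightarrow> ('a \<Rightarrow> real \<Rightarrow> real) \<Rightarrow> bool" where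
  "random_lift M f F \<longleftrightarrow>
     F \<in> M \<rightarrow>\<^sub>M uniform_borel End1_real \<and>
     (\<forall>\<omega>\<in>space M. circle_proj \<circ> F \<omega> = f \<omega> \<circ> circle_proj)"

text \<open>The set of integrable random maps, written with a tilde and a calligraphic E in the
  literature.\<close>

definition integrable_End1 :: "'a measure \<Rightarrow> ('a \<Rightarrow> real \<Rightarrow> real) set" where
  "integrable_End1 M =
     {F. F \<in> M \<rightarrow>\<^sub>M uniform_borel End1_real \<and> integrable M (\<lambda>\<omega>. sup_dist (F \<omega>) id)}"

definition lower_map :: "('a \<Rightarrow> real \<Rightarrow> real) \<Rightarrow> 'a \<Rightarrow> real \<Rightarrow> real" where
  "lower_map F \<omega> x = (INF y\<in>{x..}. F \<omega> y)"

definition upper_map :: "('a \<Rightarrow> real \<Rightarrow> real) \<Rightarrow> 'a \<Rightarrow> real \<Rightarrow> real" where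
  "upper_map F \<omega> x = (SUP y\<in>{..x}. F \<omega> y)"


section \<open>Rotation numbers\<close>

definition is_random_rotation_number ::
    "'a measure \<Rightarrow> ('a \<Rightarrow> 'a) \<Rightarrow> ('a \<Rightarrow> real \<Rightarrow> real) \<Rightarrow> ('a \<Rightarrow> real) \<Rightarrow> bool" where
  "is_random_rotation_number M \<sigma> G \<rho> \<longleftrightarrow>
     integrable M \<rho> \<and>
     (\<forall>x. AE \<omega> in M. (\<lambda>n. (cocycle \<sigma> G n \<omega> x - x) / real n) \<longlonglongrightarrow> \<rho> \<omega>)"

text \<open>The random rotation number exists for every integrable random monotone degree-one map
  (Li and Lu) and is unique up to null sets, so its integral does not depend on the choice.\<close>

definition random_rotation_number ::
    "'a measure \<Rightarrow> ('a \<Rightarrow> 'a) \<Rightarrow> ('a \<Rightarrow> real \<Rightarrow> real) \<Rightarrow> 'a \<Rightarrow> real" where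
  "random_rotation_number M \<sigma> G = (SOME \<rho>. is_random_rotation_number M \<sigma> G \<rho>)"

definition mean_rotation_number ::
    "'a measure \<Rightarrow> ('a \<Rightarrow> 'a) \<Rightarrow> ('a \<Rightarrow> real \<Rightarrow> real) \<Rightarrow> real" where
  "mean_rotation_number M \<sigma> G = (\<integral>\<omega>. random_rotation_number M \<sigma> G \<omega> \<partial>M)"


section \<open>Cluster sets\<close>

text \<open>The sequence is indexed from 1; its term of index 0 is ignored.\<close>

definition Clust :: "(nat \<Rightarrow> real) \<Rightarrow> real set" where
  "Clust u = {l. \<exists>r :: nat \<Rightarrow> nat. strict_mono r \<and> (\<forall>k. 1 \<le> r k) \<and> (u \<circ> r) \<longlonglongrightarrow> l}"

end

theory Submission
  imports Defs
begin

text \<open>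
  The lower and the upper map are monotone of degree one, so displacements of any two points
  under their compositions differ by at most 1. Fix a typical \<open>\<omega>\<close> and a target \<open>T n\<close> with
  increments in \<open>[a, b]\<close> whose means \<open>T n / n\<close> oscillate so slowly that they accumulate exactly
  at \<open>[a, b]\<close>. Apply the upper map when the current position is at most \<open>T n\<close> and the lower
  map otherwise: since \<open>\<rho>(F\<^sub>L) \<le> a\<close> and \<open>b \<le> \<rho>(F\<^sub>U)\<close>, the position stays within \<open>o(n)\<close> of
  \<open>T n\<close>. Both maps agree with \<open>F\<close> on a closed set that meets the fibre over every value, so a
  compactness argument gives a point whose orbit under \<open>F\<close> is an orbit of this mixed sequence.
\<close>

section \<open>Monotone maps of degree one\<close>

text \<open>\<open>F\<close> itself cannot be steered: without monotonicity the displacements of two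
  starting points may drift apart, so one orbit says nothing about another. The choice between the
  two monotone maps is made for one fixed \<omega>, which turns the mixed sequence into a plain
  sequence of maps governed by two numbers, the limits along the orbits of 0. These must be the
  constants of the hypothesis, but \<open>random_rotation_number\<close> is a \<open>SOME\<close>,
  about which nothing is known until a limit has been shown to exist; measurability, Birkhoff's
  theorem and almost additivity serve this purpose. The target is a sum of a wave, not n times the
  wave, because it is compared with the two rotation numbers increment by increment; the wave must
  then move slowly enough for its Cesaro means to follow it.\<close>

lemma degree_one_of_nat:
  fixes g :: "real \<Rightarrow> real"
  assumes "\<And>x. g (x + 1) = g x + 1"
  shows "g (x + of_nat n) = g x + of_nat n"
proof (induction n)
  case (Suc n)
  show ?case using assms[of "x + of_nat n"] Suc by (simp add: algebra_simps)
qed simp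

lemma degree_one_of_int:
  fixes g :: "real \<Rightarrow> real"
  assumes "\<And>x. g (x + 1) = g x + 1"
  shows "g (x + of_int k) = g x + of_int k"
proof (cases k)
  case (nonneg n)
  then show ?thesis using degree_one_of_nat[of g x n] assms by simp
next
  case (neg n)
  then show ?thesis using degree_one_of_nat[of g "x + of_int k" "Suc n"] assms by simp
qed

definition mono_degree_one :: "(real \<Rightarrow> real) \<Rightarrow> bool" where
  "mono_degree_one g \<longleftrightarrow> mono g \<and> (\<forall>x. g (x + 1) = g x + 1)"

lemma mono_degree_one_bounds:
  assumes "mono_degree_one g" "y + of_int k \<le> x" "x \<le> y + of_int k + 1"
  shows "g y + of_int k \<le> g x" "g x \<le> g y + of_int k + 1"
proof -
  have "g (y + of_int k) = g y + of_int k" for k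
    using assms(1) degree_one_of_int unfolding mono_degree_one_def by blast
  from this[of k] this[of "k + 1"] show "g y + of_int k \<le> g x" "g x \<le> g y + of_int k + 1"
    using assms monoD[of g "y + of_int k" x] monoD[of g x "y + of_int k + 1"]
    unfolding mono_degree_one_def by (auto simp: add.assoc)
qed

text \<open>Monotonicity and degree one preserve v + k \<le> u \<le> v + k + 1 for an integer k, so
  u - v stays in the unit interval in which it starts. The window from s to n is there because the
  steered orbit follows one family of maps only between two switches.\<close>

lemma mono_degree_one_run:
  assumes g: "\<And>j. s \<le> j \<Longrightarrow> j < n \<Longrightarrow> mono_degree_one (g j)"
    and u: "\<And>j. s \<le> j \<Longrightarrow> j < n \<Longrightarrow> u (Suc j) = g j (u j)"
    and v: "\<And>j. s \<le> j \<Longrightarrow> j < n \<Longrightarrow> v (Suc j) = g j (v j)"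
    and "s \<le> n"
  shows "\<bar>(u n - u s) - (v n - v s)\<bar> \<le> 1"
proof -
  define k where "k = \<lfloor>u s - v s\<rfloor>"
  have k: "v s + of_int k \<le> u s \<and> u s \<le> v s + of_int k + 1"
    unfolding k_def by linarith
  have "v j + of_int k \<le> u j \<and> u j \<le> v j + of_int k + 1" if "s \<le> j" "j \<le> n" for j
    using that
  proof (induction j rule: dec_induct)
    case base
    show ?case by (rule k)
  next
    case (step j)
    then show ?case
      using mono_degree_one_bounds[OF g, of j "v j" k "u j"] u[of j] v[of j] by auto
  qed
  from this[of n] k \<open>s \<le> n\<close> show ?thesis by (simp add: abs_le_iff)
qed

text \<open>Separate from \<open>cocycle\<close>, since the mixed sequence of lower and upper maps
  depends on the whole past and is not of the form
  \<open>f ((\<sigma> ^^ k) \<omega>)\<close>.\<close>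

primrec orbit :: "(nat \<Rightarrow> 'b \<Rightarrow> 'b) \<Rightarrow> nat \<Rightarrow> 'b \<Rightarrow> 'b" where
  "orbit g 0 x = x"
| "orbit g (Suc n) x = g n (orbit g n x)"

lemma cocycle_eq_orbit: "cocycle \<sigma> f n \<omega> x = orbit (\<lambda>k. f ((\<sigma> ^^ k) \<omega>)) n x"
  by (induction n) auto

lemma orbit_displacement_diff:
  assumes "\<And>k. mono_degree_one (g k)"
  shows "\<bar>(orbit g n x - x) - (orbit g n y - y)\<bar> \<le> 1"
  using mono_degree_one_run[of 0 n g "\<lambda>n. orbit g n x" "\<lambda>n. orbit g n y"] assms by simp

text \<open>Contact points of \<open>f k\<close> and \<open>g k\<close> lie over every value, so backward induction
  produces starting points whose two orbits agree up to any given time.\<close>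

lemma orbit_shadowing:
  fixes f g :: "nat \<Rightarrow> real \<Rightarrow> real"
  assumes cont: "\<And>k. continuous_on UNIV (f k)"
    and g: "\<And>k. mono_degree_one (g k)"
    and contact: "\<And>k v. \<exists>y. f k y = v \<and> g k y = v"
    and cl: "\<And>k. closed {y. f k y = g k y}"
  shows "\<exists>x. \<forall>n. orbit f n x = orbit g n x"
proof -
  have ex: "\<exists>x. (\<forall>k\<le>n. orbit f k x = orbit g k x) \<and> orbit g n x = v" for n v
  proof (induction n arbitrary: v)
    case (Suc n)
    obtain y where y: "f n y = v" "g n y = v" using contact by blast
    obtain x where "\<forall>k\<le>n. orbit f k x = orbit g k x" "orbit g n x = y" using Suc by blast
    with y show ?case by (intro exI[of _ x]) (auto simp: le_Suc_eq)
  qed simp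
  \<comment> \<open>The conditions are nested in n; the interval that makes \<open>K n\<close>
    compact must therefore not depend on n.\<close>
  define K where "K n = {x \<in> {-1..1}. \<forall>k<n. f k (orbit f k x) = g k (orbit f k x)}" for n
  have orbit_cont: "continuous_on UNIV (orbit f k)" for k
  proof (induction k)
    case (Suc k)
    show ?case using continuous_on_compose2[OF cont Suc] by simp
  qed (simp add: continuous_on_id)
  have "compact (K n)" for n
  proof -
    have "K n = {-1..1} \<inter> (\<Inter>k\<in>{..<n}. orbit f k -` {y. f k y = g k y})"
      by (auto simp: K_def)
    moreover have "closed (\<Inter>k\<in>{..<n}. orbit f k -` {y. f k y = g k y})"
      by (intro closed_INT ballI closed_vimage cl) (use orbit_cont in auto)
    ultimately show ?thesis by (simp add: compact_Int_closed)
  qed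
  moreover have "K n \<noteq> {}" for n
  proof -
    \<comment> \<open>With the end of the \<open>g\<close>-orbit of 0 as prescribed final value,
      comparing displacements of x and 0 gives |x| \<le> 1 for every n.\<close>
    obtain x where x: "\<forall>k\<le>n. orbit f k x = orbit g k x" "orbit g n x = orbit g n 0"
      using ex by blast
    have "\<bar>x\<bar> \<le> 1" using orbit_displacement_diff[of g n x 0] g x(2) by simp
    moreover have "f k (orbit f k x) = g k (orbit f k x)" if "k < n" for k
      using x(1)[rule_format, of k] x(1)[rule_format, of "Suc k"] that by simp
    ultimately have "x \<in> K n" by (simp add: K_def abs_le_iff)
    then show ?thesis by blast
  qed
  moreover have "K n \<subseteq> K m" if "m \<le> n" for m n
    using that by (auto simp: K_def)
  ultimately have "(\<Inter>n. K n) \<noteq> {}" by (intro compact_nest) auto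
  then obtain x where x: "\<And>n. x \<in> K n" by blast
  have "orbit f n x = orbit g n x" for n
  proof (induction n)
    case (Suc n)
    then show ?case using x[of "Suc n"] by (auto simp: K_def)
  qed simp
  then show ?thesis by blast
qed


section \<open>Lower and upper maps\<close>

text \<open>f - g is continuous and has period 1. Without this bound the real-valued
  \<open>SUP\<close> in \<open>sup_dist\<close> would carry no information.\<close>

lemma End1_real_bdd_dist:
  assumes "f \<in> End1_real" "g \<in> End1_real"
  shows "bdd_above (range (\<lambda>x. dist (f x) (g x)))"
proof -
  have "continuous_on {0..1} f" "continuous_on {0..1} g"
    using assms continuous_on_subset by (auto simp: End1_real_def)
  then have "compact ((\<lambda>x. dist (f x) (g x)) ` {0..1::real})"
    by (intro compact_continuous_image continuous_on_dist) auto
  then have "bdd_above ((\<lambda>x. dist (f x) (g x)) ` {0..1::real})"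
    by (intro bounded_imp_bdd_above compact_imp_bounded)
  then obtain B where B: "\<And>x. x \<in> {0..1} \<Longrightarrow> dist (f x) (g x) \<le> B"
    unfolding bdd_above_def by blast
  have "dist (f x) (g x) \<le> B" for x
  proof -
    have per: "h x = h (frac x) + of_int \<lfloor>x\<rfloor>" if "h \<in> End1_real" for h
      using degree_one_of_int[of h "frac x" "\<lfloor>x\<rfloor>"] that by (simp add: End1_real_def frac_def)
    have "dist (f x) (g x) = dist (f (frac x)) (g (frac x))"
      using per[OF assms(1)] per[OF assms(2)] by (simp add: dist_real_def)
    also have "\<dots> \<le> B" using frac_ge_0[of x] frac_lt_1[of x] by (intro B) simp
    finally show ?thesis .
  qed
  then show ?thesis by (auto simp: bdd_above_def)
qed

lemma dist_le_sup_dist: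
  assumes "f \<in> End1_real" "g \<in> End1_real"
  shows "dist (f x) (g x) \<le> sup_dist f g"
  unfolding sup_dist_def by (rule cSUP_upper[OF UNIV_I End1_real_bdd_dist[OF assms]])

lemma id_End1_real: "id \<in> End1_real"
  by (simp add: End1_real_def continuous_on_id id_def)

lemma displacement_le_sup_dist:
  assumes "f \<in> End1_real"
  shows "\<bar>f x - x\<bar> \<le> sup_dist f id"
  using dist_le_sup_dist[OF assms id_End1_real, of x] by (simp add: dist_real_def)

section \<open>Lower maps: order, degree, displacement and contact with F\<close>

lemma lower_map_bdd_below:
  assumes "F \<omega> \<in> End1_real"
  shows "bdd_below (F \<omega> ` {x..})"
proof (rule bdd_belowI2)
  fix y assume "y \<in> {x..}"
  then show "x - sup_dist (F \<omega>) id \<le> F \<omega> y"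
    using displacement_le_sup_dist[OF assms, of y] by simp
qed

lemma lower_map_le:
  assumes "F \<omega> \<in> End1_real" "x \<le> y"
  shows "lower_map F \<omega> x \<le> F \<omega> y"
  unfolding lower_map_def by (rule cINF_lower[OF lower_map_bdd_below]) (use assms in auto)

lemma lower_map_greatest:
  assumes "\<And>y. x \<le> y \<Longrightarrow> c \<le> F \<omega> y"
  shows "c \<le> lower_map F \<omega> x"
  unfolding lower_map_def by (rule cINF_greatest) (use assms in auto)

lemma lower_map_mono_degree_one:
  assumes "F \<omega> \<in> End1_real"
  shows "mono_degree_one (lower_map F \<omega>)"
  unfolding mono_degree_one_def
proof (intro conjI allI antisym)
  have deg: "F \<omega> (x + 1) = F \<omega> x + 1" for x using assms by (simp add: End1_real_def)
  show "mono (lower_map F \<omega>)"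
    by (intro monoI lower_map_greatest) (auto intro: lower_map_le[of F, OF assms])
  fix x
  show "lower_map F \<omega> x + 1 \<le> lower_map F \<omega> (x + 1)"
  proof (rule lower_map_greatest)
    fix y assume "x + 1 \<le> y"
    then show "lower_map F \<omega> x + 1 \<le> F \<omega> y"
      using lower_map_le[of F, OF assms, of x "y - 1"] deg[of "y - 1"] by simp
  qed
  have "lower_map F \<omega> (x + 1) - 1 \<le> lower_map F \<omega> x"
  proof (rule lower_map_greatest)
    fix y assume "x \<le> y"
    then show "lower_map F \<omega> (x + 1) - 1 \<le> F \<omega> y"
      using lower_map_le[of F, OF assms, of "x + 1" "y + 1"] deg[of "y"] by simp
  qed
  then show "lower_map F \<omega> (x + 1) \<le> lower_map F \<omega> x + 1" by simp
qed

lemma lower_map_displacement: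
  assumes "F \<omega> \<in> End1_real"
  shows "\<bar>lower_map F \<omega> x - x\<bar> \<le> sup_dist (F \<omega>) id"
proof -
  have disp: "\<bar>F \<omega> y - y\<bar> \<le> sup_dist (F \<omega>) id" for y
    by (rule displacement_le_sup_dist[OF assms])
  have "x - sup_dist (F \<omega>) id \<le> lower_map F \<omega> x"
  proof (rule lower_map_greatest)
    fix y assume "x \<le> y"
    then show "x - sup_dist (F \<omega>) id \<le> F \<omega> y" using disp[of y] by simp
  qed
  then show ?thesis
    using disp[of x] lower_map_le[of F, OF assms, of x x] by simp
qed

text \<open>The contact point is the last one with \<open>F \<omega> y \<le> v\<close>: continuity
  forces the value v there, and F exceeds v afterwards, so the infimum over all later points is
  v.\<close>

lemma lower_map_contact:
  assumes "F \<omega> \<in> End1_real"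
  shows "\<exists>y. F \<omega> y = v \<and> lower_map F \<omega> y = v"
proof -
  let ?B = "sup_dist (F \<omega>) id"
  have disp: "\<bar>F \<omega> y - y\<bar> \<le> ?B" for y by (rule displacement_le_sup_dist[OF assms])
  have cont: "continuous_on UNIV (F \<omega>)" using assms by (simp add: End1_real_def)
  define S where "S = {y. F \<omega> y \<le> v}"
  have bdd: "bdd_above S"
  proof (rule bdd_aboveI)
    fix y assume "y \<in> S"
    then show "y \<le> v + ?B" using disp[of y] by (simp add: S_def)
  qed
  have "v - ?B \<in> S" using disp[of "v - ?B"] by (simp add: S_def)
  then have ne: "S \<noteq> {}" by blast
  have "closed S" unfolding S_def by (intro closed_Collect_le cont continuous_on_const)
  then have mem: "Sup S \<in> S" by (rule closed_contains_Sup[OF ne bdd])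
  have above: "F \<omega> y > v" if "y > Sup S" for y
    using cSup_upper[OF _ bdd, of y] that by (force simp: S_def)
  have eq: "F \<omega> (Sup S) = v"
  proof (rule antisym)
    show "F \<omega> (Sup S) \<le> v" using mem by (simp add: S_def)
    have "(F \<omega> \<longlongrightarrow> F \<omega> (Sup S)) (at_right (Sup S))"
      using cont by (auto simp: continuous_on_def intro: tendsto_within_subset)
    moreover have "\<forall>\<^sub>F y in at_right (Sup S). v \<le> F \<omega> y"
      using eventually_at_right_less by eventually_elim (rule less_imp_le[OF above])
    ultimately show "v \<le> F \<omega> (Sup S)"
      by (rule tendsto_lowerbound) simp
  qed
  have "v \<le> lower_map F \<omega> (Sup S)"
    by (rule lower_map_greatest) (use above eq in \<open>force simp: le_less\<close>)
  with eq show ?thesis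
    using lower_map_le[of F, OF assms, of "Sup S" "Sup S"] by (intro exI[of _ "Sup S"]) simp
qed

text \<open>Contact at y means that no later value lies below \<open>F \<omega> y\<close>. Indexing
  the later points by their distance t writes the set as an intersection of conditions that are
  closed by continuity of F alone.\<close>

lemma lower_map_contact_closed:
  assumes "F \<omega> \<in> End1_real"
  shows "closed {y. F \<omega> y = lower_map F \<omega> y}"
proof -
  have cont: "continuous_on UNIV (F \<omega>)" using assms by (simp add: End1_real_def)
  have "F \<omega> y = lower_map F \<omega> y \<longleftrightarrow> (\<forall>t\<in>{0..}. F \<omega> y \<le> F \<omega> (y + t))" for y
  proof
    assume "F \<omega> y = lower_map F \<omega> y"
    then show "\<forall>t\<in>{0..}. F \<omega> y \<le> F \<omega> (y + t)" using lower_map_le[of F, OF assms, of y] by simp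
  next
    assume "\<forall>t\<in>{0..}. F \<omega> y \<le> F \<omega> (y + t)"
    then have "F \<omega> y \<le> F \<omega> z" if "y \<le> z" for z using that by (auto dest!: bspec[of _ _ "z - y"])
    then have "F \<omega> y \<le> lower_map F \<omega> y" by (rule lower_map_greatest)
    then show "F \<omega> y = lower_map F \<omega> y" using lower_map_le[of F, OF assms, of y y] by simp
  qed
  then have "{y. F \<omega> y = lower_map F \<omega> y} = (\<Inter>t\<in>{0..}. {y. F \<omega> y \<le> F \<omega> (y + t)})" by auto
  also have "closed \<dots>"
    by (intro closed_INT ballI closed_Collect_le cont continuous_on_compose2[OF cont] continuous_intros) auto
  finally show ?thesis .
qed

text \<open>Conjugation by x \<mapsto> -x exchanges lower and upper maps, so each fact about upper
  maps is a reflected fact about lower maps.\<close>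

definition reflection :: "('a \<Rightarrow> real \<Rightarrow> real) \<Rightarrow> 'a \<Rightarrow> real \<Rightarrow> real" where
  "reflection F \<omega> x = - F \<omega> (- x)"

lemma upper_map_eq_reflection: "upper_map F \<omega> x = - lower_map (reflection F) \<omega> (- x)"
proof -
  have "uminus ` reflection F \<omega> ` {- x..} = F \<omega> ` uminus ` {- x..}"
    by (simp add: image_image reflection_def flip: image_image[of "F \<omega>" uminus])
  then show ?thesis
    by (simp add: upper_map_def lower_map_def Inf_real_def)
qed

lemma reflection_End1_real:
  assumes "F \<omega> \<in> End1_real"
  shows "reflection F \<omega> \<in> End1_real"
proof -
  have cont: "continuous_on UNIV (F \<omega>)" using assms by (simp add: End1_real_def)
  have "reflection F \<omega> = (\<lambda>x. - F \<omega> (- x))" by (simp add: reflection_def fun_eq_iff)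
  moreover have "continuous_on UNIV (\<lambda>x. - F \<omega> (- x))"
    by (rule continuous_on_minus[OF continuous_on_compose2[OF cont continuous_on_minus[OF continuous_on_id]]])
      simp
  ultimately have "continuous_on UNIV (reflection F \<omega>)" by simp
  moreover have "reflection F \<omega> (x + 1) = reflection F \<omega> x + 1" for x
  proof -
    have "F \<omega> (- x - 1 + 1) = F \<omega> (- x - 1) + 1" using assms unfolding End1_real_def by blast
    then show ?thesis by (simp add: reflection_def)
  qed
  ultimately show ?thesis by (simp add: End1_real_def)
qed

lemma upper_map_mono_degree_one:
  assumes "F \<omega> \<in> End1_real"
  shows "mono_degree_one (upper_map F \<omega>)"
proof -
  have L: "mono_degree_one (lower_map (reflection F) \<omega>)"
    by (rule lower_map_mono_degree_one[of "reflection F" \<omega>, OF reflection_End1_real[of F \<omega>, OF assms]])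
  have "upper_map F \<omega> (x + 1) = upper_map F \<omega> x + 1" for x
  proof -
    have "lower_map (reflection F) \<omega> (- x - 1 + 1) = lower_map (reflection F) \<omega> (- x - 1) + 1"
      using L unfolding mono_degree_one_def by blast
    then show ?thesis by (simp add: upper_map_eq_reflection)
  qed
  moreover have "mono (upper_map F \<omega>)"
    unfolding upper_map_eq_reflection
    using L by (intro monoI) (simp add: mono_degree_one_def monoD)
  ultimately show ?thesis by (simp add: mono_degree_one_def)
qed

lemma upper_map_displacement:
  assumes "F \<omega> \<in> End1_real"
  shows "\<bar>upper_map F \<omega> x - x\<bar> \<le> sup_dist (F \<omega>) id"
proof -
  have "dist (reflection F \<omega> x) (id x) = dist (F \<omega> (- x)) (id (- x))" for x
    by (simp add: reflection_def dist_real_def)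
  then have "(\<lambda>x. dist (reflection F \<omega> x) (id x)) = (\<lambda>x. dist (F \<omega> x) (id x)) \<circ> uminus"
    by (simp add: fun_eq_iff)
  then have "range (\<lambda>x. dist (reflection F \<omega> x) (id x)) = (\<lambda>x. dist (F \<omega> x) (id x)) ` range uminus"
    by (simp only: image_comp)
  then have "sup_dist (reflection F \<omega>) id = sup_dist (F \<omega>) id"
    by (simp add: sup_dist_def)
  then show ?thesis
    using lower_map_displacement[of "reflection F", OF reflection_End1_real[of F, OF assms], of "- x"]
    by (simp add: upper_map_eq_reflection)
qed

lemma upper_map_contact:
  assumes "F \<omega> \<in> End1_real"
  shows "\<exists>y. F \<omega> y = v \<and> upper_map F \<omega> y = v"
proof -
  obtain y where "reflection F \<omega> y = - v" "lower_map (reflection F) \<omega> y = - v"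
    using lower_map_contact[of "reflection F", OF reflection_End1_real[of F, OF assms]] by blast
  then show ?thesis
    by (intro exI[of _ "- y"]) (simp add: upper_map_eq_reflection reflection_def)
qed

lemma upper_map_contact_closed:
  assumes "F \<omega> \<in> End1_real"
  shows "closed {y. F \<omega> y = upper_map F \<omega> y}"
proof -
  have "closed (uminus -` {y. reflection F \<omega> y = lower_map (reflection F) \<omega> y})"
    by (intro closed_vimage lower_map_contact_closed reflection_End1_real assms continuous_intros)
  moreover have "uminus -` {y. reflection F \<omega> y = lower_map (reflection F) \<omega> y}
      = {y. F \<omega> y = upper_map F \<omega> y}"
    by (auto simp: upper_map_eq_reflection reflection_def)
  ultimately show ?thesis by simp
qed


section \<open>Measurability\<close>

lemma uniform_borel_space: "space (uniform_borel E) = E"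
  unfolding uniform_borel_def by (rule space_measure_of) auto

text \<open>Evaluation is 1-Lipschitz for \<open>sup_dist\<close>, so its strict sublevel sets are
  among the generators of \<open>uniform_borel\<close>.\<close>

lemma End1_real_eval_measurable: "(\<lambda>f. f x) \<in> borel_measurable (uniform_borel End1_real)"
proof (subst borel_measurable_iff_less, intro allI)
  fix c :: real
  let ?U = "{f \<in> End1_real. f x < c}"
  have "\<exists>e>0. \<forall>g\<in>End1_real. sup_dist f g < e \<longrightarrow> g \<in> ?U" if "f \<in> ?U" for f
  proof (intro exI[of _ "c - f x"] conjI ballI impI)
    show "0 < c - f x" using that by simp
    fix g assume g: "g \<in> End1_real" "sup_dist f g < c - f x"
    then have "dist (f x) (g x) < c - f x" using dist_le_sup_dist[of f g x] that by simp
    with g(1) show "g \<in> ?U" by (simp add: dist_real_def)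
  qed
  then show "{f \<in> space (uniform_borel End1_real). f x < c} \<in> sets (uniform_borel End1_real)"
    unfolding uniform_borel_space unfolding uniform_borel_def
    by (subst sets_measure_of) (auto intro!: sigma_sets.Basic)
qed

text \<open>Approximation of \<open>F \<omega> x\<close> by its values at the points \<open>\<lfloor>n x\<rfloor> / n\<close>.\<close>

lemma random_map_joint_measurable:
  assumes F: "F \<in> M \<rightarrow>\<^sub>M uniform_borel End1_real"
  shows "case_prod F \<in> borel_measurable (M \<Otimes>\<^sub>M borel)"
proof -
  have eval: "(\<lambda>\<omega>. F \<omega> x) \<in> borel_measurable M" for x
    using measurable_compose[OF F End1_real_eval_measurable] .
  have End1: "F \<omega> \<in> End1_real" if "\<omega> \<in> space M" for \<omega>
    using measurable_space[OF F that] by (simp add: uniform_borel_space)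
  show ?thesis
  proof (rule borel_measurable_LIMSEQ_real)
    show "(\<lambda>(\<omega>, x). F \<omega> (of_int \<lfloor>real (Suc n) * x\<rfloor> / real (Suc n)))
        \<in> borel_measurable (M \<Otimes>\<^sub>M borel)" for n
      unfolding split_def
    \<comment> \<open>Once the integer value k of the floor is fixed, the point of evaluation is
      constant, and there are countably many k.\<close>
    proof (rule measurable_compose_countable[where f = "\<lambda>k p. F (fst p) (of_int k / real (Suc n))"
          and g = "\<lambda>p. \<lfloor>real (Suc n) * snd p\<rfloor>"])
      show "(\<lambda>p. F (fst p) (of_int k / real (Suc n))) \<in> borel_measurable (M \<Otimes>\<^sub>M borel)" for k
        by (rule measurable_compose[OF measurable_fst eval])
    qed measurable
    fix p assume "p \<in> space (M \<Otimes>\<^sub>M (borel :: real measure))"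
    then obtain \<omega> x where p: "p = (\<omega>, x)" "\<omega> \<in> space M" by (auto simp: space_pair_measure)
    have "(\<lambda>n. real_of_int \<lfloor>real (Suc n) * x\<rfloor> / real (Suc n)) \<longlonglongrightarrow> x"
    proof (rule real_tendsto_sandwich)
      show "(\<lambda>n. x - 1 / real (Suc n)) \<longlonglongrightarrow> x"
        using tendsto_diff[OF tendsto_const LIMSEQ_inverse_real_of_nat, of x]
        by (simp add: inverse_eq_divide)
      show "\<forall>\<^sub>F n in sequentially. x - 1 / real (Suc n) \<le> real_of_int \<lfloor>real (Suc n) * x\<rfloor> / real (Suc n)"
      proof (intro always_eventually allI)
        fix n
        have "real (Suc n) * x - 1 \<le> real_of_int \<lfloor>real (Suc n) * x\<rfloor>" by linarith
        then have "(real (Suc n) * x - 1) / real (Suc n) \<le> real_of_int \<lfloor>real (Suc n) * x\<rfloor> / real (Suc n)"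
          by (rule divide_right_mono) simp
        then show "x - 1 / real (Suc n) \<le> real_of_int \<lfloor>real (Suc n) * x\<rfloor> / real (Suc n)"
          by (simp add: diff_divide_distrib del: of_nat_Suc)
      qed
      show "\<forall>\<^sub>F n in sequentially. real_of_int \<lfloor>real (Suc n) * x\<rfloor> / real (Suc n) \<le> x"
      proof (intro always_eventually allI)
        fix n
        have "real_of_int \<lfloor>real (Suc n) * x\<rfloor> \<le> x * real (Suc n)" by (simp add: mult.commute)
        then show "real_of_int \<lfloor>real (Suc n) * x\<rfloor> / real (Suc n) \<le> x"
          by (simp only: pos_divide_le_eq of_nat_0_less_iff zero_less_Suc)
      qed
    qed simp
    moreover have "isCont (F \<omega>) x"
      using End1[OF p(2)] by (auto simp: End1_real_def continuous_on_eq_continuous_at)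
    ultimately have "(\<lambda>n. F \<omega> (of_int \<lfloor>real (Suc n) * x\<rfloor> / real (Suc n))) \<longlonglongrightarrow> F \<omega> x"
      by (rule isCont_tendsto_compose[rotated])
    then show "(\<lambda>n. case p of (\<omega>, x) \<Rightarrow> F \<omega> (of_int \<lfloor>real (Suc n) * x\<rfloor> / real (Suc n)))
        \<longlonglongrightarrow> case_prod F p"
      by (simp add: p)
  qed
qed

text \<open>Continuity of F reduces the infimum over all later points to rational shifts, a
  countable union. Joint measurability is the form required because a cocycle evaluates the map at a
  random point.\<close>

lemma lower_map_joint_measurable:
  assumes F: "case_prod F \<in> borel_measurable (M \<Otimes>\<^sub>M borel)"
    and End1: "\<And>\<omega>. \<omega> \<in> space M \<Longrightarrow> F \<omega> \<in> End1_real"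
  shows "case_prod (lower_map F) \<in> borel_measurable (M \<Otimes>\<^sub>M borel)"
proof (subst borel_measurable_iff_less, intro allI)
  fix c :: real
  let ?P = "M \<Otimes>\<^sub>M (borel :: real measure)"
  let ?T = "{t::real. t \<in> \<rat> \<and> 0 \<le> t}"
  have iff: "lower_map F \<omega> x < c \<longleftrightarrow> (\<exists>t\<in>?T. F \<omega> (x + t) < c)" if "\<omega> \<in> space M" for \<omega> x
  proof
    assume "lower_map F \<omega> x < c"
    then obtain y where y: "x \<le> y" "F \<omega> y < c"
      unfolding lower_map_def
      using cINF_less_iff[OF _ lower_map_bdd_below[of F \<omega> x], of c] End1[OF \<open>\<omega> \<in> space M\<close>] by auto
    \<comment> \<open>Since y may be x itself, the rational shift is sought to the right of y, which
      keeps it nonnegative.\<close>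
    have "isCont (F \<omega>) y"
      using End1[OF that] by (auto simp: End1_real_def continuous_on_eq_continuous_at)
    then have "\<forall>\<^sub>F z in at_right y. F \<omega> z < c"
      using y(2) by (metis at_within_le_at filter_leD isCont_def order_tendstoD(2))
    then obtain b where b: "b > y" "\<And>z. y < z \<Longrightarrow> z < b \<Longrightarrow> F \<omega> z < c"
      by (auto simp: eventually_at_right_field)
    obtain q where q: "q \<in> \<rat>" "y - x < q" "q < b - x"
      using Rats_dense_in_real[of "y - x" "b - x"] b(1) by auto
    then show "\<exists>t\<in>?T. F \<omega> (x + t) < c"
      using y(1) by (intro bexI[of _ q] b(2)) auto
  next
    assume "\<exists>t\<in>?T. F \<omega> (x + t) < c"
    then obtain t where "0 \<le> t" "F \<omega> (x + t) < c" by blast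
    then show "lower_map F \<omega> x < c"
      using lower_map_le[of F \<omega> x "x + t"] End1[OF \<open>\<omega> \<in> space M\<close>] by simp
  qed
  have "{p \<in> space ?P. case_prod (lower_map F) p < c}
      = (\<Union>t\<in>?T. {p \<in> space ?P. F (fst p) (snd p + t) < c})"
    by (auto simp: iff space_pair_measure)
  also have "\<dots> \<in> sets ?P"
  proof (rule sets.countable_UN'')
    show "countable ?T" by (rule countable_subset[OF _ countable_rat]) auto
    show "{p \<in> space ?P. F (fst p) (snd p + t) < c} \<in> sets ?P" for t
    proof -
      have "(\<lambda>p. (fst p, snd p + t)) \<in> ?P \<rightarrow>\<^sub>M ?P" by measurable
      then have [measurable]: "(\<lambda>p. F (fst p) (snd p + t)) \<in> borel_measurable ?P"
        using measurable_compose[OF _ F, of "\<lambda>p. (fst p, snd p + t)"] by simp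
      show ?thesis by measurable
    qed
  qed
  finally show "{p \<in> space ?P. case_prod (lower_map F) p < c} \<in> sets ?P" .
qed

lemma upper_map_joint_measurable:
  assumes F: "case_prod F \<in> borel_measurable (M \<Otimes>\<^sub>M borel)"
    and End1: "\<And>\<omega>. \<omega> \<in> space M \<Longrightarrow> F \<omega> \<in> End1_real"
  shows "case_prod (upper_map F) \<in> borel_measurable (M \<Otimes>\<^sub>M borel)"
proof -
  let ?P = "M \<Otimes>\<^sub>M (borel :: real measure)"
  have neg: "(\<lambda>p. (fst p, - snd p)) \<in> ?P \<rightarrow>\<^sub>M ?P" by measurable
  have "case_prod (reflection F) \<in> borel_measurable ?P"
    using borel_measurable_uminus[OF measurable_compose[OF neg F]]
    by (simp add: reflection_def split_def)
  then have "case_prod (lower_map (reflection F)) \<in> borel_measurable ?P"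
    by (intro lower_map_joint_measurable reflection_End1_real End1)
  from borel_measurable_uminus[OF measurable_compose[OF neg this]]
  show ?thesis by (simp add: upper_map_eq_reflection split_def)
qed


section \<open>Birkhoff's ergodic theorem\<close>

text \<open>Both u (n + 1) / n and u n / n tend to \<rho>. This serves the terms of a Birkhoff sum
  as well as the single steps of the lower and upper orbits.\<close>

lemma increment_sublinear:
  fixes u :: "nat \<Rightarrow> real"
  assumes "(\<lambda>n. u n / real n) \<longlonglongrightarrow> \<rho>"
  shows "(\<lambda>n. (u (Suc n) - u n) / real n) \<longlonglongrightarrow> 0"
proof -
  have "(\<lambda>n. (u (Suc n) / real (Suc n)) * (real (Suc n) / real n) - u n / real n) \<longlonglongrightarrow> \<rho> * 1 - \<rho>"
    by (intro tendsto_intros LIMSEQ_Suc[OF assms] assms LIMSEQ_Suc_n_over_n)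
  then have "(\<lambda>n. (u (Suc n) / real (Suc n)) * (real (Suc n) / real n) - u n / real n) \<longlonglongrightarrow> 0"
    by simp
  then show ?thesis
    by (rule Lim_transform_eventually)
      (intro always_eventually allI, simp add: diff_divide_distrib del: of_nat_Suc)
qed

context ergodic_system
begin

lemma shift_in_space: "\<omega> \<in> space M \<Longrightarrow> (\<sigma> ^^ n) \<omega> \<in> space M"
  using measurable_space[OF measurable_shift] by (induction n) auto

lemma measurable_shift_funpow [measurable]: "\<sigma> ^^ n \<in> M \<rightarrow>\<^sub>M M"
  by (rule measurable_compose_n[OF measurable_shift])

lemma distr_shift_funpow: "distr M M (\<sigma> ^^ n) = M"
proof (induction n)
  case 0
  show ?case by (simp add: distr_id2 id_def)
next
  case (Suc n)
  have "distr M M (\<sigma> ^^ Suc n) = distr (distr M M (\<sigma> ^^ n)) M \<sigma>"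
    by (simp only: distr_distr[OF measurable_shift measurable_shift_funpow] funpow.simps)
  then show ?case by (simp only: Suc measure_preserving)
qed

lemma integrable_shift_funpow:
  fixes g :: "'a \<Rightarrow> real"
  assumes "integrable M g"
  shows "integrable M (\<lambda>\<omega>. g ((\<sigma> ^^ n) \<omega>))"
  using integrable_distr[OF measurable_shift_funpow[of n], of g] assms
  by (simp add: distr_shift_funpow)

lemma integrable_shift:
  fixes g :: "'a \<Rightarrow> real"
  assumes "integrable M g"
  shows "integrable M (\<lambda>\<omega>. g (\<sigma> \<omega>))"
  using integrable_shift_funpow[OF assms, of 1] by simp

lemma integral_shift:
  fixes g :: "'a \<Rightarrow> real"
  assumes "integrable M g"
  shows "(\<integral>\<omega>. g (\<sigma> \<omega>) \<partial>M) = (\<integral>\<omega>. g \<omega> \<partial>M)"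
  using integral_distr[OF measurable_shift, of g] assms by (simp add: measure_preserving)

section \<open>Birkhoff sums and their running maxima\<close>

definition birkhoff_sum :: "('a \<Rightarrow> real) \<Rightarrow> nat \<Rightarrow> 'a \<Rightarrow> real" where
  "birkhoff_sum g n \<omega> = (\<Sum>k<n. g ((\<sigma> ^^ k) \<omega>))"

lemma birkhoff_sum_0: "birkhoff_sum g 0 \<omega> = 0"
  by (simp add: birkhoff_sum_def)

lemma birkhoff_sum_Suc: "birkhoff_sum g (Suc n) \<omega> = g \<omega> + birkhoff_sum g n (\<sigma> \<omega>)"
  by (simp only: birkhoff_sum_def sum.lessThan_Suc_shift funpow_Suc_right) simp

lemma birkhoff_sum_measurable [measurable]:
  assumes [measurable]: "g \<in> borel_measurable M"
  shows "birkhoff_sum g n \<in> borel_measurable M"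
  unfolding birkhoff_sum_def by measurable

text \<open>The maximum of \<open>birkhoff_sum g k\<close> over 1 \<le> k \<le> n + 1. The recursive
  form shows at once how the maximum at \<omega> compares with the one at
  \<open>\<sigma> \<omega>\<close>.\<close>

primrec birkhoff_max :: "('a \<Rightarrow> real) \<Rightarrow> nat \<Rightarrow> 'a \<Rightarrow> real" where
  "birkhoff_max g 0 \<omega> = g \<omega>"
| "birkhoff_max g (Suc n) \<omega> = g \<omega> + max 0 (birkhoff_max g n (\<sigma> \<omega>))"

lemma birkhoff_max_ge: "g \<omega> \<le> birkhoff_max g n \<omega>"
  by (cases n) auto

lemma birkhoff_sum_le_max: "k \<le> n \<Longrightarrow> birkhoff_sum g (Suc k) \<omega> \<le> birkhoff_max g n \<omega>"
proof (induction n arbitrary: k \<omega>)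
  case 0
  then show ?case by (simp add: birkhoff_sum_Suc birkhoff_sum_0)
next
  case (Suc n)
  show ?case
  proof (cases k)
    case 0
    then show ?thesis by (simp add: birkhoff_sum_Suc birkhoff_sum_0)
  next
    case (Suc j)
    with Suc.IH[of j "\<sigma> \<omega>"] Suc.prems show ?thesis
      by (simp add: birkhoff_sum_Suc[of g "Suc j"])
  qed
qed

lemma birkhoff_max_mono: "birkhoff_max g n \<omega> \<le> birkhoff_max g (Suc n) \<omega>"
proof (induction n arbitrary: \<omega>)
  case (Suc n)
  from Suc[of "\<sigma> \<omega>"] show ?case by simp
qed simp

lemma integrable_birkhoff_max: "integrable M g \<Longrightarrow> integrable M (birkhoff_max g n)"
proof (induction n)
  case 0
  have "birkhoff_max g 0 = g" by (rule ext) simp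
  with 0 show ?case by simp
next
  case (Suc n)
  have "integrable M (\<lambda>\<omega>. g \<omega> + max 0 (birkhoff_max g n (\<sigma> \<omega>)))"
    using Suc integrable_shift[OF Suc.IH] by simp
  then show ?case by simp
qed

text \<open>If the sums were unbounded, the nonnegative integrals of
  \<open>birkhoff_max g (Suc n) - birkhoff_max g n \<circ> \<sigma>\<close> would converge to the integral of \<open>g\<close>.\<close>

lemma AE_birkhoff_sum_bdd_above:
  assumes g: "integrable M g" and neg: "(\<integral>\<omega>. g \<omega> \<partial>M) < 0"
  shows "AE \<omega> in M. bdd_above (range (\<lambda>n. birkhoff_sum g n \<omega>))"
proof -
  have [measurable]: "g \<in> borel_measurable M" using g by simp
  define E where "E = {\<omega> \<in> space M. \<forall>c::nat. \<exists>n. birkhoff_sum g n \<omega> > real c}"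
  have E: "E \<in> sets M" unfolding E_def by measurable
  have bdd_iff: "\<omega> \<in> E \<longleftrightarrow> \<not> bdd_above (range (\<lambda>n. birkhoff_sum g n \<omega>))" if "\<omega> \<in> space M" for \<omega>
  proof
    assume "\<omega> \<in> E"
    show "\<not> bdd_above (range (\<lambda>n. birkhoff_sum g n \<omega>))"
    proof
      assume "bdd_above (range (\<lambda>n. birkhoff_sum g n \<omega>))"
      then obtain C where C: "\<And>n. birkhoff_sum g n \<omega> \<le> C" by (auto simp: bdd_above_def)
      obtain c :: nat where "C \<le> real c" using real_arch_simple by blast
      moreover obtain n where "birkhoff_sum g n \<omega> > real c" using \<open>\<omega> \<in> E\<close> by (auto simp: E_def)
      ultimately show False using C[of n] by linarith
    qed
  next
    assume *: "\<not> bdd_above (range (\<lambda>n. birkhoff_sum g n \<omega>))"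
    have "\<exists>n. birkhoff_sum g n \<omega> > real c" for c
    proof (rule ccontr)
      assume "\<not> ?thesis"
      then have "bdd_above (range (\<lambda>n. birkhoff_sum g n \<omega>))"
        by (intro bdd_aboveI[of _ "real c"]) (auto simp: not_less)
      with * show False by blast
    qed
    with that show "\<omega> \<in> E" by (simp add: E_def)
  qed
  \<comment> \<open>Passing to \<open>\<sigma> \<omega>\<close> drops the first term and so shifts
    all later sums by the constant \<open>g \<omega>\<close>. Hence \<open>E\<close> is exactly
    invariant and ergodicity applies.\<close>
  have shift_bdd: "bdd_above (range (\<lambda>n. birkhoff_sum g n (\<sigma> \<omega>)))
      \<longleftrightarrow> bdd_above (range (\<lambda>n. birkhoff_sum g n \<omega>))" for \<omega>
  proof
    assume "bdd_above (range (\<lambda>n. birkhoff_sum g n (\<sigma> \<omega>)))"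
    then obtain C where C: "\<And>n. birkhoff_sum g n (\<sigma> \<omega>) \<le> C" by (auto simp: bdd_above_def)
    have "birkhoff_sum g n \<omega> \<le> max 0 (g \<omega> + C)" for n
      using C[of "n - 1"] by (cases n) (auto simp: birkhoff_sum_0 birkhoff_sum_Suc)
    then show "bdd_above (range (\<lambda>n. birkhoff_sum g n \<omega>))" by (auto simp: bdd_above_def)
  next
    assume "bdd_above (range (\<lambda>n. birkhoff_sum g n \<omega>))"
    then obtain C where C: "\<And>n. birkhoff_sum g n \<omega> \<le> C" by (auto simp: bdd_above_def)
    have "birkhoff_sum g n (\<sigma> \<omega>) \<le> C - g \<omega>" for n
      using C[of "Suc n"] by (simp add: birkhoff_sum_Suc)
    then show "bdd_above (range (\<lambda>n. birkhoff_sum g n (\<sigma> \<omega>)))" by (auto simp: bdd_above_def)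
  qed
  have "E \<subseteq> space M" by (auto simp: E_def)
  then have "\<sigma> -` E \<inter> space M = E"
    using bdd_iff shift_bdd measurable_space[OF measurable_shift]
    by (intro set_eqI) (metis IntE IntI subsetD vimageE vimageI)
  then consider "prob E = 0" | "prob E = 1" using ergodic[OF E] by blast
  then have "prob E = 0"
  proof cases
    case 2
    have AE_E: "AE \<omega> in M. \<omega> \<in> E" using 2 prob_eq_1[OF E] by simp
    define D where "D n \<omega> = birkhoff_max g (Suc n) \<omega> - birkhoff_max g n (\<sigma> \<omega>)" for n \<omega>
    have D_int: "integrable M (D n)" for n
      unfolding D_def
      by (rule Bochner_Integration.integrable_diff[OF integrable_birkhoff_max[OF g]
            integrable_shift[OF integrable_birkhoff_max[OF g]]])
    have nonneg: "(\<integral>\<omega>. D n \<omega> \<partial>M) \<ge> 0" for n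
    proof -
      have "(\<integral>\<omega>. D n \<omega> \<partial>M)
          = (\<integral>\<omega>. birkhoff_max g (Suc n) \<omega> \<partial>M) - (\<integral>\<omega>. birkhoff_max g n \<omega> \<partial>M)"
        unfolding D_def using integrable_birkhoff_max[OF g] integrable_shift[OF integrable_birkhoff_max[OF g]]
        by (simp only: Bochner_Integration.integral_diff integral_shift)
      also have "\<dots> \<ge> 0"
        using integral_mono[OF integrable_birkhoff_max[OF g] integrable_birkhoff_max[OF g] birkhoff_max_mono]
        by simp
      finally show ?thesis .
    qed
    \<comment> \<open>On \<open>E\<close> some sum along \<open>\<sigma> \<omega>\<close> is
      positive; from then on the truncation at 0 in the recursion is inactive and
      \<open>D n \<omega>\<close> equals \<open>g \<omega>\<close>.\<close>
    have lim: "(\<lambda>n. D n \<omega>) \<longlonglongrightarrow> g \<omega>" if "\<omega> \<in> E" for \<omega>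
    proof -
      have sp: "\<omega> \<in> space M" using that by (simp add: E_def)
      have "\<sigma> \<omega> \<in> E"
        using bdd_iff[OF measurable_space[OF measurable_shift sp]] bdd_iff[OF sp] shift_bdd[of \<omega>] that
        by simp
      then obtain k where k: "birkhoff_sum g k (\<sigma> \<omega>) > real 0" unfolding E_def by blast
      then obtain j where j: "k = Suc j" by (cases k) (auto simp: birkhoff_sum_0)
      have "D n \<omega> = g \<omega>" if "n \<ge> j" for n
        using birkhoff_sum_le_max[OF that, of g "\<sigma> \<omega>"] k j by (simp add: D_def)
      then show ?thesis by (intro tendsto_eventually) (auto simp: eventually_sequentially)
    qed
    have "(\<lambda>n. \<integral>\<omega>. D n \<omega> \<partial>M) \<longlonglongrightarrow> (\<integral>\<omega>. g \<omega> \<partial>M)"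
    \<comment> \<open>\<open>D n \<omega>\<close> exceeds \<open>g \<omega>\<close> by the negative
      part of \<open>birkhoff_max g n (\<sigma> \<omega>)\<close>, which is at most |g (\<sigma>
      \<omega>)| because the maximum is at least its first term.\<close>
    proof (rule integral_dominated_convergence[where w = "\<lambda>\<omega>. \<bar>g \<omega>\<bar> + \<bar>g (\<sigma> \<omega>)\<bar>"])
      show "integrable M (\<lambda>\<omega>. \<bar>g \<omega>\<bar> + \<bar>g (\<sigma> \<omega>)\<bar>)"
        using g integrable_shift[OF g] by simp
      show "AE \<omega> in M. (\<lambda>n. D n \<omega>) \<longlonglongrightarrow> g \<omega>" using AE_E by eventually_elim (rule lim)
      show "AE \<omega> in M. norm (D n \<omega>) \<le> \<bar>g \<omega>\<bar> + \<bar>g (\<sigma> \<omega>)\<bar>" for n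
      proof (rule AE_I2)
        fix \<omega>
        show "norm (D n \<omega>) \<le> \<bar>g \<omega>\<bar> + \<bar>g (\<sigma> \<omega>)\<bar>"
          using birkhoff_max_ge[of g "\<sigma> \<omega>" n] unfolding D_def birkhoff_max.simps real_norm_def
          by linarith
      qed
    qed (use D_int g in auto)
    then have "0 \<le> (\<integral>\<omega>. g \<omega> \<partial>M)"
      by (rule LIMSEQ_le_const) (use nonneg in auto)
    with neg show ?thesis by simp
  qed
  then have "AE \<omega> in M. \<omega> \<notin> E"
    using prob_eq_0[OF E] by simp
  then show ?thesis
    using AE_space by eventually_elim (use bdd_iff in simp)
qed

text \<open>Subtracting the mean plus e/2 makes the integral negative, so the sums are bounded
  above; the bound divided by n uses up the other e/2.\<close>

lemma AE_birkhoff_limsup: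
  assumes g: "integrable M g" and "e > 0"
  shows "AE \<omega> in M. eventually (\<lambda>n. birkhoff_sum g n \<omega> / real n < (\<integral>\<omega>. g \<omega> \<partial>M) + e) sequentially"
proof -
  let ?I = "\<integral>\<omega>. g \<omega> \<partial>M"
  let ?h = "\<lambda>\<omega>. g \<omega> - (?I + e / 2)"
  have "integrable M ?h" using g by simp
  moreover have "(\<integral>\<omega>. ?h \<omega> \<partial>M) < 0" using g \<open>e > 0\<close> by (simp add: prob_space)
  ultimately have "AE \<omega> in M. bdd_above (range (\<lambda>n. birkhoff_sum ?h n \<omega>))"
    by (rule AE_birkhoff_sum_bdd_above)
  then show ?thesis
  proof (rule AE_mp, intro AE_I2 impI)
    fix \<omega> assume "bdd_above (range (\<lambda>n. birkhoff_sum ?h n \<omega>))"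
    then obtain C where C: "\<And>n. birkhoff_sum ?h n \<omega> \<le> C" by (auto simp: bdd_above_def)
    have sum_h: "birkhoff_sum ?h n \<omega> = birkhoff_sum g n \<omega> - n * (?I + e / 2)" for n
      by (simp add: birkhoff_sum_def sum_subtractf)
    have "eventually (\<lambda>n. C / real n < e / 2) sequentially"
      by (rule order_tendstoD(2)[OF lim_const_over_n]) (use \<open>e > 0\<close> in simp)
    then show "eventually (\<lambda>n. birkhoff_sum g n \<omega> / real n < ?I + e) sequentially"
      using eventually_gt_at_top[of 0]
    proof eventually_elim
      case (elim n)
      have "birkhoff_sum g n \<omega> / n \<le> (C + n * (?I + e / 2)) / n"
        using C[of n] elim by (intro divide_right_mono) (auto simp: sum_h)
      also have "\<dots> = C / n + (?I + e / 2)" using elim by (simp add: add_divide_distrib)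
      finally show ?case using elim by linarith
    qed
  qed
qed

text \<open>The one-sided bound is applied to g and to -g, with the tolerances 1/(k + 1) so that
  countably many null sets are discarded.\<close>

lemma AE_birkhoff:
  assumes g: "integrable M g"
  shows "AE \<omega> in M. (\<lambda>n. birkhoff_sum g n \<omega> / real n) \<longlonglongrightarrow> (\<integral>\<omega>. g \<omega> \<partial>M)"
proof -
  let ?I = "\<integral>\<omega>. g \<omega> \<partial>M"
  have up: "AE \<omega> in M. \<forall>k. eventually (\<lambda>n. birkhoff_sum g n \<omega> / real n < ?I + 1 / Suc k) sequentially"
    using AE_birkhoff_limsup[OF g] by (simp add: AE_all_countable)
  have "AE \<omega> in M. \<forall>k. eventually (\<lambda>n. birkhoff_sum (\<lambda>\<omega>. - g \<omega>) n \<omega> / real n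
      < (\<integral>\<omega>. - g \<omega> \<partial>M) + 1 / Suc k) sequentially"
    using AE_birkhoff_limsup[of "\<lambda>\<omega>. - g \<omega>"] g by (simp add: AE_all_countable)
  then have lo: "AE \<omega> in M. \<forall>k. eventually (\<lambda>n. birkhoff_sum g n \<omega> / real n > ?I - 1 / Suc k) sequentially"
  proof (rule AE_mp, intro AE_I2 impI allI)
    fix \<omega> and k :: nat
    assume "\<forall>k. eventually (\<lambda>n. birkhoff_sum (\<lambda>\<omega>. - g \<omega>) n \<omega> / real n
      < (\<integral>\<omega>. - g \<omega> \<partial>M) + 1 / Suc k) sequentially"
    then have "eventually (\<lambda>n. birkhoff_sum (\<lambda>\<omega>. - g \<omega>) n \<omega> / real n
      < (\<integral>\<omega>. - g \<omega> \<partial>M) + 1 / Suc k) sequentially" by blast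
    then show "eventually (\<lambda>n. birkhoff_sum g n \<omega> / real n > ?I - 1 / Suc k) sequentially"
      by eventually_elim (simp add: birkhoff_sum_def sum_negf)
  qed
  from up lo show ?thesis
  proof eventually_elim
    case (elim \<omega>)
    show ?case
    proof (rule tendstoI)
      fix e :: real assume "e > 0"
      then obtain k where k: "1 / real (Suc k) < e" using nat_approx_posE by blast
      from elim(1)[rule_format, of k] elim(2)[rule_format, of k]
      show "eventually (\<lambda>n. dist (birkhoff_sum g n \<omega> / real n) ?I < e) sequentially"
        by eventually_elim (use k in \<open>auto simp: dist_real_def\<close>)
    qed
  qed
qed

lemma AE_shift_sublinear:
  assumes g: "integrable M g"
  shows "AE \<omega> in M. (\<lambda>n. g ((\<sigma> ^^ n) \<omega>) / real n) \<longlonglongrightarrow> 0"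
  using AE_birkhoff[OF g]
proof eventually_elim
  case (elim \<omega>)
  from increment_sublinear[OF this] show ?case by (simp add: birkhoff_sum_def)
qed

end


section \<open>Rotation numbers of monotone random maps\<close>

text \<open>All \<open>R m N\<close> approximate the same \<open>x N\<close>, so letting N grow
  shows that the \<open>J m\<close> form a Cauchy sequence. This yields a limit of x that is not
  known beforehand.\<close>

lemma tendsto_lim_approximants:
  fixes x :: "nat \<Rightarrow> real"
  assumes R: "\<And>m. R m \<longlonglongrightarrow> J m"
    and close: "\<And>m N. N \<ge> 1 \<Longrightarrow> \<bar>x N - R m N\<bar> \<le> 1 / real (Suc m) + 1 / real N"
  shows "x \<longlonglongrightarrow> lim J"
proof -
  have JJ: "\<bar>J m - J k\<bar> \<le> 1 / real (Suc m) + 1 / real (Suc k)" for m k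
  proof (rule LIMSEQ_le)
    show "(\<lambda>N. \<bar>R m N - R k N\<bar>) \<longlonglongrightarrow> \<bar>J m - J k\<bar>"
      by (intro tendsto_rabs tendsto_diff R)
    have "(\<lambda>N. 1 / real (Suc m) + 1 / real (Suc k) + 2 / real N)
        \<longlonglongrightarrow> 1 / real (Suc m) + 1 / real (Suc k) + 0"
      by (intro tendsto_add tendsto_const lim_const_over_n)
    then show "(\<lambda>N. 1 / real (Suc m) + 1 / real (Suc k) + 2 / real N)
        \<longlonglongrightarrow> 1 / real (Suc m) + 1 / real (Suc k)" by simp
    have "\<bar>R m N - R k N\<bar> \<le> 1 / real (Suc m) + 1 / real (Suc k) + 2 / real N" if "N \<ge> 1" for N
    proof -
      have "2 / real N = 1 / real N + 1 / real N" by simp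
      with close[OF that, of m] close[OF that, of k] show ?thesis by linarith
    qed
    then show "\<exists>N0. \<forall>N\<ge>N0. \<bar>R m N - R k N\<bar> \<le> 1 / real (Suc m) + 1 / real (Suc k) + 2 / real N"
      by blast
  qed
  have "Cauchy J"
  proof (rule metric_CauchyI)
    fix e :: real assume "e > 0"
    then obtain K where K: "1 / real (Suc K) < e / 2" using nat_approx_posE[of "e / 2"] by auto
    have "dist (J m) (J k) < e" if "m \<ge> K" "k \<ge> K" for m k
    proof -
      have "1 / real (Suc m) \<le> 1 / real (Suc K)" "1 / real (Suc k) \<le> 1 / real (Suc K)"
        using that by (auto intro!: divide_left_mono simp del: of_nat_Suc)
      with JJ[of m k] K show ?thesis unfolding dist_real_def by linarith
    qed
    then show "\<exists>K. \<forall>m\<ge>K. \<forall>k\<ge>K. dist (J m) (J k) < e" by blast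
  qed
  then have J: "J \<longlonglongrightarrow> lim J" by (simp add: Cauchy_convergent convergent_LIMSEQ_iff[symmetric])
  show ?thesis
  proof (rule tendstoI)
    fix e :: real assume e: "e > 0"
    have "eventually (\<lambda>m. 1 / real (Suc m) < e / 4) sequentially"
      using order_tendstoD(2)[OF LIMSEQ_inverse_real_of_nat, of "e / 4"] e
      by (simp add: inverse_eq_divide)
    moreover have "eventually (\<lambda>m. dist (J m) (lim J) < e / 4) sequentially"
      using tendstoD[OF J, of "e / 4"] e by simp
    ultimately have "eventually (\<lambda>m. 1 / real (Suc m) < e / 4 \<and> dist (J m) (lim J) < e / 4) sequentially"
      by eventually_elim simp
    then obtain m where m: "1 / real (Suc m) < e / 4" "dist (J m) (lim J) < e / 4"
      unfolding eventually_sequentially by blast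
    have "eventually (\<lambda>N. dist (R m N) (J m) < e / 4) sequentially"
      using tendstoD[OF R, of "e / 4"] e by simp
    moreover have "eventually (\<lambda>N. 1 / real N < e / 4) sequentially"
      by (rule order_tendstoD(2)[OF lim_const_over_n]) (use e in simp)
    ultimately show "eventually (\<lambda>N. dist (x N) (lim J) < e) sequentially"
      using eventually_ge_at_top[of 1]
    proof eventually_elim
      case (elim N)
      with close[OF elim(3), of m] m show ?case unfolding dist_real_def by linarith
    qed
  qed
qed

section \<open>Almost additivity of monotone cocycles\<close>

lemma cocycle_add:
  "cocycle \<sigma> g (n + m) \<omega> x = cocycle \<sigma> g m ((\<sigma> ^^ n) \<omega>) (cocycle \<sigma> g n \<omega> x)"
proof (induction m)
  case (Suc m)
  have "(\<sigma> ^^ (n + m)) \<omega> = (\<sigma> ^^ m) ((\<sigma> ^^ n) \<omega>)"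
    by (subst add.commute) (simp add: funpow_add)
  with Suc show ?case by simp
qed simp

text \<open>Both sides are the sum of a over N..N+m-1 minus that over 0..m-1. It trades N terms for
  the fixed number m, each of which can be treated as an error.\<close>

lemma sum_shift_telescope:
  fixes a :: "nat \<Rightarrow> real"
  shows "(\<Sum>j<N. a (j + m) - a j) = (\<Sum>i<m. a (N + i) - a i)"
proof (induction N)
  case (Suc N)
  have "(\<Sum>i<m. a (Suc N + i) - a i) = (\<Sum>i<m. a (N + Suc i) - a (N + i)) + (\<Sum>i<m. a (N + i) - a i)"
    by (simp add: sum.distrib[symmetric])
  also have "(\<Sum>i<m. a (N + Suc i) - a (N + i)) = a (N + m) - a N"
    using sum_lessThan_telescope[of "\<lambda>i. a (N + i)" m] by simp
  finally show ?case using Suc by (simp add: add.commute)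
qed simp

context ergodic_system
begin

text \<open>With \<open>A n = cocycle \<sigma> G n \<omega> 0\<close>, which is additive along orbits up to an error 1,
  the number \<open>m * A N\<close> differs from the Birkhoff sum of \<open>A m\<close> over \<open>N\<close> steps by at most
  \<open>N + m\<close> and finitely many sublinear terms, so Birkhoff's theorem for the
  ergodic map \<open>\<sigma>\<close> itself replaces the subadditive ergodic theorem.\<close>

lemma monotone_cocycle_limit:
  assumes G: "\<And>\<omega>. \<omega> \<in> space M \<Longrightarrow> mono_degree_one (G \<omega>)"
    and joint: "case_prod G \<in> borel_measurable (M \<Otimes>\<^sub>M borel)"
    and disp: "\<And>\<omega> x. \<omega> \<in> space M \<Longrightarrow> \<bar>G \<omega> x - x\<bar> \<le> B \<omega>"
    and B: "integrable M B"
  shows "\<exists>c. \<forall>x. AE \<omega> in M. (\<lambda>n. (cocycle \<sigma> G n \<omega> x - x) / real n) \<longlonglongrightarrow> c"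
proof -
  define A where "A n \<omega> = cocycle \<sigma> G n \<omega> 0" for n \<omega>
  have diff: "\<bar>(cocycle \<sigma> G n \<omega> x - x) - A n \<omega>\<bar> \<le> 1" if "\<omega> \<in> space M" for n \<omega> x
    using orbit_displacement_diff[of "\<lambda>k. G ((\<sigma> ^^ k) \<omega>)" n x 0] G shift_in_space[OF that]
    by (simp add: A_def cocycle_eq_orbit)
  have almost: "\<bar>A (n + m) \<omega> - A n \<omega> - A m ((\<sigma> ^^ n) \<omega>)\<bar> \<le> 1" if "\<omega> \<in> space M" for n m \<omega>
    using diff[OF shift_in_space[OF that, of n], of m "A n \<omega>"]
    by (simp add: A_def cocycle_add)
  have meas: "A n \<in> borel_measurable M" for n
  proof (induction n)
    case 0
    have "A 0 = (\<lambda>_. 0)" by (simp add: A_def fun_eq_iff)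
    then show ?case by simp
  next
    case (Suc n)
    have "(\<lambda>\<omega>. ((\<sigma> ^^ n) \<omega>, A n \<omega>)) \<in> M \<rightarrow>\<^sub>M M \<Otimes>\<^sub>M borel"
      by (intro measurable_Pair measurable_shift_funpow Suc)
    from measurable_compose[OF this joint] show ?case by (simp add: A_def)
  qed
  have bound: "\<bar>A n \<omega>\<bar> \<le> (\<Sum>k<n. B ((\<sigma> ^^ k) \<omega>))" if "\<omega> \<in> space M" for n \<omega>
  proof (induction n)
    case (Suc n)
    have "A (Suc n) \<omega> = G ((\<sigma> ^^ n) \<omega>) (A n \<omega>)" by (simp add: A_def)
    with Suc disp[OF shift_in_space[OF that, of n], of "A n \<omega>"] show ?case by simp
  qed (simp add: A_def)
  have A_int: "integrable M (A n)" for n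
  proof (rule Bochner_Integration.integrable_bound)
    show "integrable M (\<lambda>\<omega>. \<Sum>k<n. B ((\<sigma> ^^ k) \<omega>))"
      by (intro Bochner_Integration.integrable_sum integrable_shift_funpow B)
    show "AE \<omega> in M. norm (A n \<omega>) \<le> norm (\<Sum>k<n. B ((\<sigma> ^^ k) \<omega>))"
    proof (rule AE_I2)
      fix \<omega> assume "\<omega> \<in> space M"
      from bound[OF this, of n] show "norm (A n \<omega>) \<le> norm (\<Sum>k<n. B ((\<sigma> ^^ k) \<omega>))"
        unfolding real_norm_def by linarith
    qed
  qed (rule meas)
  \<comment> \<open>The boundary terms are divided by N one by one so that the limit can be taken
    termwise for fixed m.\<close>
  define R where "R m \<omega> N = (birkhoff_sum (A m) N \<omega> / real N
      + (\<Sum>i<m. A i \<omega> / real N - A i ((\<sigma> ^^ N) \<omega>) / real N)) / real m" for m \<omega> N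
  have close: "\<bar>A N \<omega> / real N - R m \<omega> N\<bar> \<le> 1 / real m + 1 / real N"
    if sp: "\<omega> \<in> space M" and N: "N \<ge> 1" and m: "m \<ge> 1" for \<omega> m N
  proof -
    define X where "X = birkhoff_sum (A m) N \<omega> + (\<Sum>i<m. A i \<omega> - A i ((\<sigma> ^^ N) \<omega>))"
    \<comment> \<open>Almost additivity enters twice: splitting \<open>A (j + m)\<close> at time j
      costs N in total and, after telescoping, splitting \<open>A (N + i)\<close> at time N costs
      m.\<close>
    have "\<bar>\<Sum>j<N. A (j + m) \<omega> - A j \<omega> - A m ((\<sigma> ^^ j) \<omega>)\<bar> \<le> (\<Sum>j<N. 1)"
      by (rule order_trans[OF sum_abs sum_mono]) (rule almost[OF sp])
    moreover have "(\<Sum>j<N. A (j + m) \<omega> - A j \<omega> - A m ((\<sigma> ^^ j) \<omega>))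
        = (\<Sum>i<m. A (N + i) \<omega> - A i \<omega>) - birkhoff_sum (A m) N \<omega>"
      unfolding sum_shift_telescope[of "\<lambda>j. A j \<omega>", symmetric]
      by (simp add: birkhoff_sum_def sum_subtractf)
    moreover have "\<bar>\<Sum>i<m. A (N + i) \<omega> - A N \<omega> - A i ((\<sigma> ^^ N) \<omega>)\<bar> \<le> (\<Sum>i<m. 1)"
      by (rule order_trans[OF sum_abs sum_mono]) (rule almost[OF sp])
    moreover have "(\<Sum>i<m. A (N + i) \<omega> - A N \<omega> - A i ((\<sigma> ^^ N) \<omega>))
        = (\<Sum>i<m. A (N + i) \<omega> - A i \<omega>) + (\<Sum>i<m. A i \<omega> - A i ((\<sigma> ^^ N) \<omega>)) - real m * A N \<omega>"
      by (simp add: sum_subtractf)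
    ultimately have "\<bar>real m * A N \<omega> - X\<bar> \<le> real m + real N"
      by (simp add: X_def abs_le_iff)
    then have "\<bar>real m * A N \<omega> - X\<bar> / (real m * real N) \<le> (real m + real N) / (real m * real N)"
      by (rule divide_right_mono) simp
    moreover have "R m \<omega> N = X / (real m * real N)"
      by (simp add: R_def X_def add_divide_distrib sum_divide_distrib diff_divide_distrib mult.commute)
    moreover have "A N \<omega> / real N - X / (real m * real N) = (real m * A N \<omega> - X) / (real m * real N)"
      using m by (simp add: diff_divide_distrib)
    moreover have "(real m + real N) / (real m * real N) = 1 / real m + 1 / real N"
      using m N by (simp add: field_simps)
    ultimately show ?thesis by (simp add: abs_mult)
  qed
  define c where "c = lim (\<lambda>m. (\<integral>\<omega>. A (Suc m) \<omega> \<partial>M) / real (Suc m))"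
  have "AE \<omega> in M. \<forall>m. (\<lambda>n. birkhoff_sum (A m) n \<omega> / real n) \<longlonglongrightarrow> (\<integral>\<omega>. A m \<omega> \<partial>M)"
    unfolding AE_all_countable by (intro allI AE_birkhoff A_int)
  moreover have "AE \<omega> in M. \<forall>m. (\<lambda>n. A m ((\<sigma> ^^ n) \<omega>) / real n) \<longlonglongrightarrow> 0"
    unfolding AE_all_countable by (intro allI AE_shift_sublinear A_int)
  ultimately have A_lim: "AE \<omega> in M. (\<lambda>n. A n \<omega> / real n) \<longlonglongrightarrow> c"
    using AE_space
  proof eventually_elim
    case (elim \<omega>)
    show ?case unfolding c_def
    proof (rule tendsto_lim_approximants)
      fix m
      have "R (Suc m) \<omega> \<longlonglongrightarrow> ((\<integral>\<omega>. A (Suc m) \<omega> \<partial>M) + (\<Sum>i<Suc m. 0 - 0)) / real (Suc m)"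
        unfolding R_def
        by (intro tendsto_divide tendsto_add tendsto_sum tendsto_diff elim(1)[rule_format]
            elim(2)[rule_format] lim_const_over_n tendsto_const) simp
      then show "R (Suc m) \<omega> \<longlonglongrightarrow> (\<integral>\<omega>. A (Suc m) \<omega> \<partial>M) / real (Suc m)" by simp
      fix N :: nat assume "N \<ge> 1"
      with close[OF elim(3) this, of "Suc m"]
      show "\<bar>A N \<omega> / real N - R (Suc m) \<omega> N\<bar> \<le> 1 / real (Suc m) + 1 / real N" by simp
    qed
  qed
  have "AE \<omega> in M. (\<lambda>n. (cocycle \<sigma> G n \<omega> x - x) / real n) \<longlonglongrightarrow> c" for x
    using A_lim AE_space
  proof eventually_elim
    case (elim \<omega>)
    have "(\<lambda>n. (cocycle \<sigma> G n \<omega> x - x) / real n - A n \<omega> / real n) \<longlonglongrightarrow> 0"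
    proof (rule Lim_null_comparison)
      show "\<forall>\<^sub>F n in sequentially. norm ((cocycle \<sigma> G n \<omega> x - x) / real n - A n \<omega> / real n) \<le> 1 / real n"
        using diff[OF elim(2)] by (intro always_eventually allI)
          (simp add: diff_divide_distrib[symmetric] divide_right_mono)
      show "(\<lambda>n. 1 / real n) \<longlonglongrightarrow> 0" by (rule lim_const_over_n)
    qed
    from tendsto_add[OF this elim(1)] show ?case by simp
  qed
  then show ?thesis by blast
qed

text \<open>The constant limit witnesses existence, so the function picked by \<open>SOME\<close> is
  a genuine rotation number; uniqueness of limits makes it equal to that constant almost
  everywhere.\<close>

lemma AE_mean_rotation_number:
  assumes "\<And>\<omega>. \<omega> \<in> space M \<Longrightarrow> mono_degree_one (G \<omega>)"
    and "case_prod G \<in> borel_measurable (M \<Otimes>\<^sub>M borel)"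
    and "\<And>\<omega> x. \<omega> \<in> space M \<Longrightarrow> \<bar>G \<omega> x - x\<bar> \<le> B \<omega>"
    and "integrable M B"
  shows "AE \<omega> in M. (\<lambda>n. (cocycle \<sigma> G n \<omega> x - x) / real n) \<longlonglongrightarrow> mean_rotation_number M \<sigma> G"
proof -
  obtain c where c: "\<And>x. AE \<omega> in M. (\<lambda>n. (cocycle \<sigma> G n \<omega> x - x) / real n) \<longlonglongrightarrow> c"
    using monotone_cocycle_limit[of G B] assms by blast
  define \<rho> where "\<rho> = random_rotation_number M \<sigma> G"
  have "is_random_rotation_number M \<sigma> G (\<lambda>_. c)"
    using c by (simp add: is_random_rotation_number_def)
  then have \<rho>: "is_random_rotation_number M \<sigma> G \<rho>"
    unfolding \<rho>_def random_rotation_number_def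
    by (rule someI[of "is_random_rotation_number M \<sigma> G"])
  then have "AE \<omega> in M. (\<lambda>n. (cocycle \<sigma> G n \<omega> 0 - 0) / real n) \<longlonglongrightarrow> \<rho> \<omega>"
    unfolding is_random_rotation_number_def by blast
  with c[of 0] have "AE \<omega> in M. \<rho> \<omega> = c"
    by eventually_elim (blast intro: LIMSEQ_unique)
  then have "(\<integral>\<omega>. \<rho> \<omega> \<partial>M) = (\<integral>\<omega>. c \<partial>M)"
    using \<rho> by (intro integral_cong_AE) (auto simp: is_random_rotation_number_def)
  then have "mean_rotation_number M \<sigma> G = c"
    by (simp add: mean_rotation_number_def \<rho>_def prob_space)
  with c show ?thesis by simp
qed

end


section \<open>Steering between the lower and the upper maps\<close>

text \<open>A bound for all n, not only large ones, is what the steering estimate needs: it is used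
  at the last switching time, which may be small or close to n.\<close>

lemma sublinear_bound:
  fixes z :: "nat \<Rightarrow> real"
  assumes "(\<lambda>n. z n / real n) \<longlonglongrightarrow> 0" "e > 0"
  obtains C where "C \<ge> 0" "\<And>n. \<bar>z n\<bar> \<le> C + e * real n"
proof -
  have "eventually (\<lambda>n. \<bar>z n / real n\<bar> < e) sequentially"
    using tendstoD[OF assms] by (simp add: dist_real_def)
  then obtain N where N: "\<And>n. n \<ge> N \<Longrightarrow> \<bar>z n / real n\<bar> < e"
    unfolding eventually_sequentially by blast
  define C where "C = (\<Sum>k\<le>N. \<bar>z k\<bar>)"
  have "C \<ge> 0" unfolding C_def by (rule sum_nonneg) simp
  moreover have "\<bar>z n\<bar> \<le> C + e * real n" for n
  proof (cases "n \<le> N")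
    case True
    then have "\<bar>z n\<bar> \<le> C" unfolding C_def by (intro member_le_sum) auto
    then show ?thesis using assms(2) by (simp add: add_increasing2)
  next
    case False
    then have "\<bar>z n\<bar> \<le> e * real n" using N[of n] by (simp add: field_simps abs_divide)
    then show ?thesis using \<open>C \<ge> 0\<close> by linarith
  qed
  ultimately show thesis by (rule that)
qed

text \<open>After the last time \<open>s\<close> at which \<open>p\<close> was not above its target, \<open>p\<close> makes one step
  that may overshoot by a sublinear amount and then follows \<open>l\<close>, which on average
  grows no faster than the target.\<close>

lemma greedy_upper_bound:
  fixes p l T e :: "nat \<Rightarrow> real"
  assumes run: "\<And>s n. s \<le> n \<Longrightarrow> (\<And>j. s \<le> j \<Longrightarrow> j < n \<Longrightarrow> T j < p j) \<Longrightarrow> p n - p s \<le> l n - l s + 1"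
    and step: "\<And>n. p (Suc n) - p n \<le> e n"
    and e: "(\<lambda>n. e n / real n) \<longlonglongrightarrow> 0"
    and l: "(\<lambda>n. l n / real n) \<longlonglongrightarrow> \<rho>"
    and T: "\<And>n. \<rho> \<le> T (Suc n) - T n"
    and init: "p 0 \<le> T 0"
    and "\<epsilon> > 0"
  shows "eventually (\<lambda>n. (p n - T n) / real n < \<epsilon>) sequentially"
proof -
  define d where "d n = l n - \<rho> * real n" for n
  have "(\<lambda>n. l n / real n - \<rho>) \<longlonglongrightarrow> 0" using l by (simp add: LIM_zero_iff)
  then have "(\<lambda>n. d n / real n) \<longlonglongrightarrow> 0"
    by (rule Lim_transform_eventually)
      (use eventually_gt_at_top[of 0] in \<open>eventually_elim, simp add: d_def diff_divide_distrib\<close>)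
  \<comment> \<open>Three sublinear errors will be added, each at most
    \<open>\<epsilon> / 8 * real n\<close> up to a constant, which fits into
    \<open>\<epsilon> / 2 * real n\<close>; the other half of \<epsilon> absorbs the
    constants.\<close>
  then obtain D where D: "D \<ge> 0" "\<And>n. \<bar>d n\<bar> \<le> D + \<epsilon> / 8 * real n"
    by (rule sublinear_bound[of d "\<epsilon> / 8"]) (use \<open>\<epsilon> > 0\<close> in auto)
  obtain C where C: "C \<ge> 0" "\<And>n. \<bar>e n\<bar> \<le> C + \<epsilon> / 8 * real n"
    by (rule sublinear_bound[OF e, of "\<epsilon> / 8"]) (use \<open>\<epsilon> > 0\<close> in auto)
  have T_mono: "T s + \<rho> * real (n - s) \<le> T n" if "s \<le> n" for s n
    using that
  proof (induction n rule: dec_induct)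
    case (step n)
    then show ?case using T[of n] by (simp add: Suc_diff_le algebra_simps)
  qed simp
  have bound: "p n - T n \<le> (C + 2 * D + 1 + \<bar>\<rho>\<bar>) + \<epsilon> / 2 * real n" for n
  proof (cases "p n \<le> T n")
    case True
    have "0 \<le> \<epsilon> / 2 * real n" using \<open>\<epsilon> > 0\<close> by simp
    with True C(1) D(1) show ?thesis by linarith
  next
    case False
    define s where "s = Max {j. j \<le> n \<and> p j \<le> T j}"
    have fin: "finite {j. j \<le> n \<and> p j \<le> T j}" by simp
    have "s \<in> {j. j \<le> n \<and> p j \<le> T j}"
      unfolding s_def by (rule Max_in[OF fin]) (use init in auto)
    then have s: "s \<le> n" "p s \<le> T s" by auto
    with False have "Suc s \<le> n" by (metis le_neq_implies_less Suc_leI)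
    have above: "T j < p j" if "Suc s \<le> j" "j < n" for j
      using Max_ge[OF fin, of j] that unfolding s_def[symmetric] by force
    have "p n - p (Suc s) \<le> l n - l (Suc s) + 1"
      by (rule run[OF \<open>Suc s \<le> n\<close> above])
    \<comment> \<open>The run along l has one step fewer than the n - s steps of the target; the
      missing \<rho> is the source of \<open>\<bar>\<rho>\<bar>\<close> in the constant.\<close>
    also have "l n - l (Suc s) = d n - d (Suc s) + \<rho> * real (n - s) - \<rho>"
      using \<open>Suc s \<le> n\<close> by (simp add: d_def of_nat_diff algebra_simps)
    finally have "p n - T n \<le> e s + d n - d (Suc s) - \<rho> + 1"
      using step[of s] s(2) T_mono[OF s(1)] by linarith
    moreover have "\<epsilon> / 8 * real s \<le> \<epsilon> / 8 * real n" "\<epsilon> / 8 * real (Suc s) \<le> \<epsilon> / 8 * real n"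
      using \<open>Suc s \<le> n\<close> \<open>\<epsilon> > 0\<close> by (auto intro!: mult_left_mono simp del: of_nat_Suc)
    moreover have "0 \<le> \<epsilon> / 8 * real n" using \<open>\<epsilon> > 0\<close> by simp
    moreover have "\<epsilon> / 2 * real n = 4 * (\<epsilon> / 8 * real n)" by simp
    ultimately show ?thesis
      using C(2)[of s] D(2)[of n] D(2)[of "Suc s"] by linarith
  qed
  let ?K = "C + 2 * D + 1 + \<bar>\<rho>\<bar>"
  have "eventually (\<lambda>n. ?K / real n < \<epsilon> / 2) sequentially"
    by (rule order_tendstoD(2)[OF lim_const_over_n]) (use \<open>\<epsilon> > 0\<close> in simp)
  then show ?thesis using eventually_gt_at_top[of 0]
  proof eventually_elim
    case (elim n)
    have "(p n - T n) / real n \<le> (?K + \<epsilon> / 2 * real n) / real n"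
      by (rule divide_right_mono[OF bound]) simp
    also have "\<dots> = ?K / real n + \<epsilon> / 2" using elim by (simp add: add_divide_distrib)
    finally show ?case using elim by linarith
  qed
qed

text \<open>The bound from below is the bound from above for -p, -T and the negated upper orbit,
  with \<open>- \<rho>\<^sub>U\<close> as rate. A tie p n = T n calls the upper map; this harms
  neither side, as a run is defined by strict inequalities.\<close>

lemma greedy_tracking:
  fixes lo up :: "nat \<Rightarrow> real \<Rightarrow> real" and T :: "nat \<Rightarrow> real"
  assumes lo: "\<And>k. mono_degree_one (lo k)" and up: "\<And>k. mono_degree_one (up k)"
    and lo_lim: "(\<lambda>n. orbit lo n 0 / real n) \<longlonglongrightarrow> \<rho>\<^sub>L"
    and up_lim: "(\<lambda>n. orbit up n 0 / real n) \<longlonglongrightarrow> \<rho>\<^sub>U"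
    and T: "\<And>n. \<rho>\<^sub>L \<le> T (Suc n) - T n" "\<And>n. T (Suc n) - T n \<le> \<rho>\<^sub>U" and T0: "T 0 = 0"
  shows "\<exists>g. (\<forall>k. g k = lo k \<or> g k = up k) \<and> (\<lambda>n. (orbit g n 0 - T n) / real n) \<longlonglongrightarrow> 0"
proof -
  let ?l = "\<lambda>n. orbit lo n 0" and ?u = "\<lambda>n. orbit up n 0"
  define p where "p = rec_nat 0 (\<lambda>n x. if x \<le> T n then up n x else lo n x)"
  have p0: "p 0 = 0" and pS: "p (Suc n) = (if p n \<le> T n then up n (p n) else lo n (p n))" for n
    by (simp_all add: p_def)
  define g where "g k = (if p k \<le> T k then up k else lo k)" for k
  have p_orbit: "orbit g n 0 = p n" for n
    by (induction n) (simp_all add: p0 pS g_def)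
  \<comment> \<open>A step of a monotone map from any point differs by at most 1 from its step along
    the orbit of 0, and the latter is sublinear.\<close>
  define e where "e n = \<bar>?l (Suc n) - ?l n\<bar> + \<bar>?u (Suc n) - ?u n\<bar> + 1" for n
  have "(\<lambda>n. \<bar>(?l (Suc n) - ?l n) / real n\<bar> + \<bar>(?u (Suc n) - ?u n) / real n\<bar> + 1 / real n)
      \<longlonglongrightarrow> \<bar>0\<bar> + \<bar>0\<bar> + 0"
    by (intro tendsto_add tendsto_rabs increment_sublinear[OF lo_lim] increment_sublinear[OF up_lim]
        lim_const_over_n)
  then have e_lim: "(\<lambda>n. e n / real n) \<longlonglongrightarrow> 0"
    by (simp add: e_def add_divide_distrib abs_divide)
  have step: "\<bar>p (Suc n) - p n\<bar> \<le> e n" for n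
  proof (cases "p n \<le> T n")
    case True
    then have "\<bar>(p (Suc n) - p n) - (?u (Suc n) - ?u n)\<bar> \<le> 1"
      by (intro mono_degree_one_run[where g = up]) (auto simp: up pS less_Suc_eq_le le_antisym)
    then show ?thesis unfolding e_def by linarith
  next
    case False
    then have "\<bar>(p (Suc n) - p n) - (?l (Suc n) - ?l n)\<bar> \<le> 1"
      by (intro mono_degree_one_run[where g = lo]) (auto simp: lo pS less_Suc_eq_le le_antisym)
    then show ?thesis unfolding e_def by linarith
  qed
  have run_lo: "p n - p s \<le> ?l n - ?l s + 1"
    if "s \<le> n" "\<And>j. s \<le> j \<Longrightarrow> j < n \<Longrightarrow> T j < p j" for s n
  proof -
    have "\<bar>(p n - p s) - (?l n - ?l s)\<bar> \<le> 1"
      by (rule mono_degree_one_run[where g = lo])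
        (use that lo in \<open>auto simp: pS not_le[symmetric]\<close>)
    then show ?thesis by linarith
  qed
  have run_up: "- p n - - p s \<le> - ?u n - - ?u s + 1"
    if "s \<le> n" "\<And>j. s \<le> j \<Longrightarrow> j < n \<Longrightarrow> - T j < - p j" for s n
  proof -
    have "\<bar>(p n - p s) - (?u n - ?u s)\<bar> \<le> 1"
      by (rule mono_degree_one_run[where g = up])
        (use that up in \<open>auto simp: pS less_imp_le\<close>)
    then show ?thesis by linarith
  qed
  have "(\<lambda>n. (p n - T n) / real n) \<longlonglongrightarrow> 0"
  proof (rule tendstoI)
    fix \<epsilon> :: real assume \<epsilon>: "\<epsilon> > 0"
    have "eventually (\<lambda>n. (p n - T n) / real n < \<epsilon>) sequentially"
    proof (rule greedy_upper_bound[where p = p and l = ?l and e = e and \<rho> = "\<rho>\<^sub>L"])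
      show "p (Suc n) - p n \<le> e n" for n using step[of n] by linarith
    qed (use run_lo e_lim lo_lim T(1) \<epsilon> in \<open>simp_all add: p0 T0\<close>)
    moreover have "eventually (\<lambda>n. (- p n - - T n) / real n < \<epsilon>) sequentially"
    proof (rule greedy_upper_bound[where p = "\<lambda>n. - p n" and T = "\<lambda>n. - T n" and l = "\<lambda>n. - ?u n"
          and e = e and \<rho> = "- \<rho>\<^sub>U"])
      show "- p n - - p s \<le> - ?u n - - ?u s + 1"
        if "s \<le> n" "\<And>j. s \<le> j \<Longrightarrow> j < n \<Longrightarrow> - T j < - p j" for s n
        by (rule run_up[OF that])
      show "- p (Suc n) - - p n \<le> e n" for n using step[of n] by linarith
      show "(\<lambda>n. - ?u n / real n) \<longlonglongrightarrow> - \<rho>\<^sub>U" using tendsto_minus[OF up_lim] by simp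
      show "- \<rho>\<^sub>U \<le> - T (Suc n) - - T n" for n using T(2)[of n] by linarith
    qed (use e_lim \<epsilon> in \<open>simp_all add: p0 T0\<close>)
    ultimately show "eventually (\<lambda>n. dist ((p n - T n) / real n) 0 < \<epsilon>) sequentially"
    proof eventually_elim
      case (elim n)
      have "(- p n - - T n) / real n = - ((p n - T n) / real n)" by (simp add: diff_divide_distrib)
      with elim show ?case unfolding dist_real_def by linarith
    qed
  qed
  moreover have "\<forall>k. g k = lo k \<or> g k = up k" by (simp add: g_def)
  ultimately show ?thesis by (intro exI[of _ g]) (simp add: p_orbit)
qed


section \<open>A slowly oscillating target\<close>

lemma cesaro_zero:
  fixes z :: "nat \<Rightarrow> real"
  assumes "z \<longlonglongrightarrow> 0"
  shows "(\<lambda>n. (\<Sum>j<n. z j) / real n) \<longlonglongrightarrow> 0"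
proof (rule tendstoI)
  fix e :: real assume e: "e > 0"
  have "eventually (\<lambda>n. \<bar>z n\<bar> < e / 2) sequentially"
    using tendstoD[OF assms, of "e / 2"] e by (simp add: dist_real_def)
  then obtain N where N: "\<And>n. n \<ge> N \<Longrightarrow> \<bar>z n\<bar> < e / 2"
    unfolding eventually_sequentially by blast
  define C where "C = (\<Sum>j<N. \<bar>z j\<bar>)"
  have bound: "\<bar>\<Sum>j<n. z j\<bar> \<le> C + e / 2 * real n" for n
  proof -
    have "\<bar>\<Sum>j<n. z j\<bar> \<le> (\<Sum>j<n. \<bar>z j\<bar>)" by (rule sum_abs)
    also have "\<dots> \<le> (\<Sum>j<n. (if j \<in> {..<N} then \<bar>z j\<bar> else 0) + e / 2)"
    proof (rule sum_mono)
      fix j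
      show "\<bar>z j\<bar> \<le> (if j \<in> {..<N} then \<bar>z j\<bar> else 0) + e / 2"
        using N[of j] e by (cases "j < N") simp_all
    qed
    also have "\<dots> = (\<Sum>j\<in>{..<n} \<inter> {..<N}. \<bar>z j\<bar>) + e / 2 * real n"
      unfolding sum.inter_restrict[OF finite_lessThan] sum.distrib by simp
    also have "(\<Sum>j\<in>{..<n} \<inter> {..<N}. \<bar>z j\<bar>) \<le> C"
      unfolding C_def by (rule sum_mono2) auto
    finally show ?thesis by simp
  qed
  have "eventually (\<lambda>n. C / real n < e / 2) sequentially"
    by (rule order_tendstoD(2)[OF lim_const_over_n]) (use e in simp)
  then show "eventually (\<lambda>n. dist ((\<Sum>j<n. z j) / real n) 0 < e) sequentially"
    using eventually_gt_at_top[of 0]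
  proof eventually_elim
    case (elim n)
    have "\<bar>\<Sum>j<n. z j\<bar> / real n \<le> (C + e / 2 * real n) / real n"
      by (rule divide_right_mono[OF bound]) simp
    also have "\<dots> = C / real n + e / 2" using elim by (simp add: add_divide_distrib)
    finally have "\<bar>\<Sum>j<n. z j\<bar> / real n < e" using elim by linarith
    then show ?case by (simp add: dist_real_def)
  qed
qed

text \<open>Summation by parts: the difference is the Cesaro mean of the sequence in the hypothesis,
  which says that the increments of t are o(1/n).\<close>

lemma mean_of_slowly_varying:
  fixes t :: "nat \<Rightarrow> real"
  assumes "(\<lambda>n. real (Suc n) * (t n - t (Suc n))) \<longlonglongrightarrow> 0"
  shows "(\<lambda>n. (\<Sum>j<n. t j) / real n - t n) \<longlonglongrightarrow> 0"
proof -
  have "(\<Sum>j<n. real (Suc j) * (t j - t (Suc j))) = (\<Sum>j<n. t j) - real n * t n" for n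
    by (induction n) (simp_all add: algebra_simps)
  with cesaro_zero[OF assms]
  have "(\<lambda>n. ((\<Sum>j<n. t j) - real n * t n) / real n) \<longlonglongrightarrow> 0" by simp
  then show ?thesis
    by (rule Lim_transform_eventually)
      (use eventually_gt_at_top[of 0] in \<open>eventually_elim, simp add: diff_divide_distrib\<close>)
qed

lemma ln_ln_diff_le:
  fixes x y :: real
  assumes "1 < x" "x \<le> y"
  shows "0 \<le> ln (ln y) - ln (ln x)" "ln (ln y) - ln (ln x) \<le> (y - x) / (x * ln x)"
proof -
  have pos: "0 < ln x" "ln x \<le> ln y" using assms by simp_all
  then show "0 \<le> ln (ln y) - ln (ln x)" by simp
  have "ln (ln y) - ln (ln x) \<le> (ln y - ln x) / ln x"
    by (rule ln_diff_le) (use pos in auto)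
  also have "\<dots> \<le> ((y - x) / x) / ln x"
    by (intro divide_right_mono ln_diff_le) (use assms pos in auto)
  finally show "ln (ln y) - ln (ln x) \<le> (y - x) / (x * ln x)" by simp
qed

lemma abs_sin_diff_le: "\<bar>sin x - sin y\<bar> \<le> \<bar>x - y\<bar>" for x y :: real
proof -
  have "\<bar>sin x - sin y\<bar> = 2 * \<bar>sin ((x - y) / 2)\<bar> * \<bar>cos ((x + y) / 2)\<bar>"
    by (simp add: sin_diff_sin abs_mult)
  also have "\<dots> \<le> 2 * \<bar>(x - y) / 2\<bar> * 1"
    by (intro mult_mono abs_sin_x_le_abs_x) auto
  finally show ?thesis by simp
qed

text \<open>The iterated logarithm has derivative 1/(x ln x) = o(1/x), as
  \<open>mean_of_slowly_varying\<close> demands; a single logarithm would be too fast. It is still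
  unbounded, so the sine runs through all its values infinitely often. The shift 3 keeps both
  logarithms positive.\<close>

definition slow_wave :: "real \<Rightarrow> real \<Rightarrow> nat \<Rightarrow> real" where
  "slow_wave a b n = a + (b - a) * ((1 + sin (ln (ln (real n + 3)))) / 2)"

lemma slow_wave_range:
  assumes "a \<le> b"
  shows "slow_wave a b n \<in> {a..b}"
proof -
  define s where "s = (1 + sin (ln (ln (real n + 3)))) / 2"
  have half: "0 \<le> (1 + t) / 2 \<and> (1 + t) / 2 \<le> 1" if "- 1 \<le> t" "t \<le> 1" for t :: real
    using that by simp
  have "0 \<le> s" "s \<le> 1"
    using half[OF sin_ge_minus_one sin_le_one, of "ln (ln (real n + 3))"] by (simp_all only: s_def)
  then have "0 \<le> (b - a) * s \<and> (b - a) * s \<le> (b - a) * 1"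
    using assms by (intro conjI mult_nonneg_nonneg mult_left_mono) simp_all
  then show ?thesis by (simp add: slow_wave_def flip: s_def)
qed

lemma ln_at_top_nat: "filterlim (\<lambda>n. ln (real n + 3)) at_top sequentially"
proof (rule filterlim_compose[OF ln_at_top])
  show "filterlim (\<lambda>n. real n + 3) at_top sequentially"
    using filterlim_tendsto_add_at_top[OF tendsto_const[of 3] filterlim_real_sequentially]
    by (simp add: add.commute)
qed

lemma slow_wave_mean: "(\<lambda>n. (\<Sum>j<n. slow_wave a b j) / real n - slow_wave a b n) \<longlonglongrightarrow> 0"
proof (rule mean_of_slowly_varying, rule Lim_null_comparison)
  show "(\<lambda>n. \<bar>b - a\<bar> / ln (real n + 3)) \<longlonglongrightarrow> 0"
    by (rule tendsto_divide_0[OF tendsto_const filterlim_at_top_imp_at_infinity[OF ln_at_top_nat]])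
  show "\<forall>\<^sub>F n in sequentially. norm (real (Suc n) * (slow_wave a b n - slow_wave a b (Suc n)))
      \<le> \<bar>b - a\<bar> / ln (real n + 3)"
  proof (intro always_eventually allI)
    fix n
    let ?x = "real n + 3" and ?y = "real (Suc n) + 3"
    have diff_half: "a + d * ((1 + s) / 2) - (a + d * ((1 + t) / 2)) = d / 2 * (s - t)" for d s t :: real
      by (simp add: field_simps)
    have cancel: "x * (d / 2 * (1 / (x * l))) \<le> d / l" if "0 < x" "0 \<le> d" "0 < l" for x d l :: real
      using that by (simp add: field_simps)
    have ln_pos: "0 < ln ?x" by simp
    have ll: "0 \<le> ln (ln ?y) - ln (ln ?x)" "ln (ln ?y) - ln (ln ?x) \<le> 1 / (?x * ln ?x)"
      using ln_ln_diff_le[of ?x ?y] by simp_all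
    have "slow_wave a b n - slow_wave a b (Suc n) = (b - a) / 2 * (sin (ln (ln ?x)) - sin (ln (ln ?y)))"
      unfolding slow_wave_def by (rule diff_half)
    then have "\<bar>slow_wave a b n - slow_wave a b (Suc n)\<bar>
        = \<bar>b - a\<bar> / 2 * \<bar>sin (ln (ln ?x)) - sin (ln (ln ?y))\<bar>"
      by (simp only: abs_mult abs_divide abs_numeral)
    also have "\<dots> \<le> \<bar>b - a\<bar> / 2 * (1 / (?x * ln ?x))"
      using abs_sin_diff_le[of "ln (ln ?x)" "ln (ln ?y)"] ll by (intro mult_left_mono) (linarith, simp)
    finally have "norm (real (Suc n) * (slow_wave a b n - slow_wave a b (Suc n)))
        \<le> ?x * (\<bar>b - a\<bar> / 2 * (1 / (?x * ln ?x)))"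
      unfolding real_norm_def abs_mult by (intro mult_mono) auto
    also have "\<dots> \<le> \<bar>b - a\<bar> / ln ?x"
      by (rule cancel) (use ln_pos in simp_all)
    finally show "norm (real (Suc n) * (slow_wave a b n - slow_wave a b (Suc n)))
        \<le> \<bar>b - a\<bar> / ln (real n + 3)" .
  qed
qed

lemma slow_wave_accumulates:
  assumes "c \<in> {a..b}"
  shows "\<exists>r. filterlim r at_top sequentially \<and> (slow_wave a b \<circ> r) \<longlonglongrightarrow> c"
proof -
  \<comment> \<open>If a = b any angle will do; otherwise the relative position z of c in the
    interval is inverted by arcsin.\<close>
  obtain \<theta> where \<theta>: "c = a + (b - a) * ((1 + sin \<theta>) / 2)"
  proof (cases "a = b")
    case True
    with assms show thesis by (intro that[of 0]) simp
  next
    case False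
    define z where "z = (c - a) / (b - a)"
    have "0 \<le> z" "z \<le> 1" using assms False by (auto simp: z_def)
    then have "sin (arcsin (2 * z - 1)) = 2 * z - 1" by (intro sin_arcsin) simp_all
    moreover have "c = a + (b - a) * z" using False by (simp add: z_def)
    ultimately show thesis by (intro that[of "arcsin (2 * z - 1)"]) simp
  qed
  \<comment> \<open>These are the real points at which the iterated logarithm equals \<theta> modulo
    2 pi; rounding to integers has a vanishing effect at this scale.\<close>
  define x where "x k = exp (exp (\<theta> + real k * (2 * pi)))" for k :: nat
  define r where "r k = nat \<lceil>x k\<rceil>" for k
  have lin: "filterlim (\<lambda>k. \<theta> + real k * (2 * pi)) at_top sequentially"
    by (intro filterlim_tendsto_add_at_top[OF tendsto_const]
        filterlim_at_top_mult_tendsto_pos[OF tendsto_const] filterlim_real_sequentially) simp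
  have x_lim: "filterlim x at_top sequentially"
    unfolding x_def by (intro filterlim_compose[OF exp_at_top] lin)
  have x1: "x k > 1" for k by (simp add: x_def)
  have r_ge: "x k \<le> real (r k)" "real (r k) \<le> x k + 1" for k
    using x1[of k] unfolding r_def by linarith+
  have r_real: "filterlim (\<lambda>k. real (r k)) at_top sequentially"
    by (rule filterlim_at_top_mono[OF x_lim]) (use r_ge in auto)
  then have r_lim: "filterlim r at_top sequentially"
    by (simp add: filterlim_sequentially_iff_filterlim_real)
  have "(\<lambda>k. ln (ln (real (r k) + 3)) - (\<theta> + real k * (2 * pi))) \<longlonglongrightarrow> 0"
  proof (rule Lim_null_comparison)
    have "filterlim (\<lambda>k. ln (x k)) at_top sequentially"
      by (rule filterlim_compose[OF ln_at_top x_lim])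
    then show "(\<lambda>k. 4 / ln (x k)) \<longlonglongrightarrow> 0"
      by (intro tendsto_divide_0[OF tendsto_const filterlim_at_top_imp_at_infinity])
    show "\<forall>\<^sub>F k in sequentially. norm (ln (ln (real (r k) + 3)) - (\<theta> + real k * (2 * pi))) \<le> 4 / ln (x k)"
    proof (intro always_eventually allI)
      fix k
      have eq: "\<theta> + real k * (2 * pi) = ln (ln (x k))" by (simp add: x_def)
      have ln_pos: "0 < ln (x k)" using x1[of k] by simp
      \<comment> \<open>Rounding up contributes at most 1 and the shift in the wave contributes 3,
        hence the 4.\<close>
      have "(real (r k) + 3 - x k) / (x k * ln (x k)) \<le> 4 / (1 * ln (x k))"
        using r_ge[of k] x1[of k] ln_pos by (intro frac_le mult_right_mono mult_pos_pos) auto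
      then show "norm (ln (ln (real (r k) + 3)) - (\<theta> + real k * (2 * pi))) \<le> 4 / ln (x k)"
        using ln_ln_diff_le[of "x k" "real (r k) + 3"] x1[of k] r_ge[of k] unfolding eq by simp
    qed
  qed
  from tendsto_add[OF this tendsto_const[of \<theta>]]
  have "(\<lambda>k. ln (ln (real (r k) + 3)) - real k * (2 * pi)) \<longlonglongrightarrow> \<theta>" by simp
  then have "(\<lambda>k. sin (ln (ln (real (r k) + 3)) - real k * (2 * pi))) \<longlonglongrightarrow> sin \<theta>"
    by (rule tendsto_sin)
  moreover have "sin (y - real k * (2 * pi)) = sin y" for y k
    using sin.minus_of_nat[of y k] by simp
  ultimately have "(\<lambda>k. sin (ln (ln (real (r k) + 3)))) \<longlonglongrightarrow> sin \<theta>" by simp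
  then have "(\<lambda>k. slow_wave a b (r k)) \<longlonglongrightarrow> c"
    unfolding slow_wave_def \<theta>
    by (intro tendsto_add tendsto_mult tendsto_divide tendsto_const) simp_all
  with r_lim show ?thesis by (auto simp: o_def)
qed

text \<open>The indices r need not increase and may repeat. Strictly increasing ones are selected
  inductively, the k-th with error below 1/(k + 1).\<close>

lemma ClustI:
  assumes r: "filterlim r at_top sequentially" and lim: "(u \<circ> r) \<longlonglongrightarrow> c"
  shows "c \<in> Clust u"
proof -
  have ex: "\<exists>n\<ge>m. 1 \<le> n \<and> \<bar>u n - c\<bar> < 1 / real (Suc k)" for m k
  proof -
    have "eventually (\<lambda>i. dist ((u \<circ> r) i) c < 1 / real (Suc k)) sequentially"
      by (rule tendstoD[OF lim]) simp
    moreover have "eventually (\<lambda>i. max 1 m \<le> r i) sequentially"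
      using r unfolding filterlim_at_top by blast
    ultimately have "eventually (\<lambda>i. dist ((u \<circ> r) i) c < 1 / real (Suc k) \<and> max 1 m \<le> r i) sequentially"
      by eventually_elim simp
    then obtain i where "dist ((u \<circ> r) i) c < 1 / real (Suc k)" "max 1 m \<le> r i"
      unfolding eventually_sequentially by blast
    then show ?thesis by (intro exI[of _ "r i"]) (simp add: dist_real_def)
  qed
  have "\<exists>q. \<forall>k. (1 \<le> q k \<and> \<bar>u (q k) - c\<bar> < 1 / real (Suc k)) \<and> q k < q (Suc k)"
  proof (rule dependent_nat_choice)
    show "\<exists>n. 1 \<le> n \<and> \<bar>u n - c\<bar> < 1 / real (Suc 0)" using ex[of 0 0] by blast
    show "\<exists>n'. (1 \<le> n' \<and> \<bar>u n' - c\<bar> < 1 / real (Suc (Suc k))) \<and> n < n'" for n k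
      using ex[of "Suc n" "Suc k"] by (auto simp: Suc_le_eq)
  qed
  then obtain q where q: "\<And>k. 1 \<le> q k" "\<And>k. \<bar>u (q k) - c\<bar> < 1 / real (Suc k)" "\<And>k. q k < q (Suc k)"
    by blast
  have "(\<lambda>k. u (q k) - c) \<longlonglongrightarrow> 0"
  proof (rule Lim_null_comparison)
    show "\<forall>\<^sub>F k in sequentially. norm (u (q k) - c) \<le> 1 / real (Suc k)"
      using q(2) by (simp add: less_imp_le)
    show "(\<lambda>k. 1 / real (Suc k)) \<longlonglongrightarrow> 0"
      using LIMSEQ_inverse_real_of_nat by (simp add: inverse_eq_divide)
  qed
  then have "(u \<circ> q) \<longlonglongrightarrow> c" by (simp add: LIM_zero_iff o_def)
  moreover have "strict_mono q" using q(3) by (simp add: strict_mono_Suc_iff)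
  ultimately show ?thesis using q(1) unfolding Clust_def by blast
qed

text \<open>A null perturbation does not affect limits along subsequences; closedness of the
  interval gives one inclusion and the oscillation of the wave the other.\<close>

lemma Clust_eq_slow_wave_range:
  assumes u: "(\<lambda>n. u n - slow_wave a b n) \<longlonglongrightarrow> 0" and "a \<le> b"
  shows "Clust u = {a..b}"
proof (intro equalityI subsetI)
  fix c assume "c \<in> Clust u"
  then obtain r where r: "strict_mono r" "(u \<circ> r) \<longlonglongrightarrow> c" unfolding Clust_def by blast
  have "(\<lambda>k. u (r k) - (u (r k) - slow_wave a b (r k))) \<longlonglongrightarrow> c - 0"
    using r(2) LIMSEQ_subseq_LIMSEQ[OF u r(1)] by (intro tendsto_diff) (simp_all add: o_def)
  then have "(\<lambda>k. slow_wave a b (r k)) \<longlonglongrightarrow> c" by simp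
  then show "c \<in> {a..b}"
    by (rule closed_sequentially[OF closed_atLeastAtMost, rotated]) (rule slow_wave_range[OF \<open>a \<le> b\<close>])
next
  fix c assume "c \<in> {a..b}"
  then obtain r where r: "filterlim r at_top sequentially" "(slow_wave a b \<circ> r) \<longlonglongrightarrow> c"
    using slow_wave_accumulates by blast
  have "(\<lambda>k. (u (r k) - slow_wave a b (r k)) + slow_wave a b (r k)) \<longlonglongrightarrow> 0 + c"
    using r(2) filterlim_compose[OF u r(1)] by (intro tendsto_add) (simp_all add: o_def)
  then have "(u \<circ> r) \<longlonglongrightarrow> c" by (simp add: o_def)
  with r(1) show "c \<in> Clust u" by (rule ClustI)
qed


section \<open>Realization of intervals as cluster sets\<close>

text \<open>The deterministic core, to be used for one \<omega> at a time: f, lo and up stand for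
  the maps met along the orbit of \<omega> under the shift.\<close>

lemma orbit_with_cluster_interval:
  fixes f lo up :: "nat \<Rightarrow> real \<Rightarrow> real"
  assumes cont: "\<And>k. continuous_on UNIV (f k)"
    and lo: "\<And>k. mono_degree_one (lo k)" "\<And>k v. \<exists>y. f k y = v \<and> lo k y = v" "\<And>k. closed {y. f k y = lo k y}"
    and up: "\<And>k. mono_degree_one (up k)" "\<And>k v. \<exists>y. f k y = v \<and> up k y = v" "\<And>k. closed {y. f k y = up k y}"
    and lo_lim: "(\<lambda>n. orbit lo n 0 / real n) \<longlonglongrightarrow> \<rho>\<^sub>L"
    and up_lim: "(\<lambda>n. orbit up n 0 / real n) \<longlonglongrightarrow> \<rho>\<^sub>U"
    and ab: "\<rho>\<^sub>L \<le> a" "a \<le> b" "b \<le> \<rho>\<^sub>U"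
  shows "\<exists>x. Clust (\<lambda>n. (orbit f n x - x) / real n) = {a..b}"
proof -
  define T where "T n = (\<Sum>j<n. slow_wave a b j)" for n
  have "\<rho>\<^sub>L \<le> T (Suc n) - T n" "T (Suc n) - T n \<le> \<rho>\<^sub>U" for n
    using slow_wave_range[OF ab(2), of n] ab by (auto simp: T_def)
  moreover have "T 0 = 0" by (simp add: T_def)
  ultimately obtain g where g: "\<And>k. g k = lo k \<or> g k = up k"
    and track: "(\<lambda>n. (orbit g n 0 - T n) / real n) \<longlonglongrightarrow> 0"
    using greedy_tracking[OF lo(1) up(1) lo_lim up_lim, of T] by blast
  have g_mono: "mono_degree_one (g k)" for k using g[of k] lo(1) up(1) by auto
  have "\<exists>x. \<forall>n. orbit f n x = orbit g n x"
  proof (rule orbit_shadowing[OF cont g_mono])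
    show "\<exists>y. f k y = v \<and> g k y = v" for k v using g[of k] lo(2) up(2) by auto
    show "closed {y. f k y = g k y}" for k using g[of k] lo(3)[of k] up(3)[of k] by auto
  qed
  then obtain x where x: "\<And>n. orbit f n x = orbit g n x" by blast
  have near: "(\<lambda>n. ((orbit g n x - x) - orbit g n 0) / real n) \<longlonglongrightarrow> 0"
  proof (rule Lim_null_comparison)
    show "\<forall>\<^sub>F n in sequentially. norm (((orbit g n x - x) - orbit g n 0) / real n) \<le> 1 / real n"
      using orbit_displacement_diff[of g _ x 0] g_mono
      by (intro always_eventually allI) (simp add: divide_right_mono)
    show "(\<lambda>n. 1 / real n) \<longlonglongrightarrow> 0" by (rule lim_const_over_n)
  qed
  have "(\<lambda>n. T n / real n - slow_wave a b n) \<longlonglongrightarrow> 0"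
    unfolding T_def by (rule slow_wave_mean)
  \<comment> \<open>Three null errors add up: the change of starting point from 0 to x, the steering
    error, and the distance of the wave from its Cesaro mean.\<close>
  from tendsto_add[OF tendsto_add[OF near track] this]
  have "(\<lambda>n. (orbit f n x - x) / real n - slow_wave a b n) \<longlonglongrightarrow> 0 + 0 + 0"
    by (rule Lim_transform_eventually)
      (intro always_eventually allI, simp add: x diff_divide_distrib)
  then have "(\<lambda>n. (orbit f n x - x) / real n - slow_wave a b n) \<longlonglongrightarrow> 0" by simp
  then have "Clust (\<lambda>n. (orbit f n x - x) / real n) = {a..b}"
    by (rule Clust_eq_slow_wave_range[OF _ ab(2)])
  then show ?thesis by blast
qed

theorem corollary2p1:
  fixes M :: "'a measure" and \<sigma> :: "'a \<Rightarrow> 'a"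
    and f :: "'a \<Rightarrow> circle \<Rightarrow> circle" and F :: "'a \<Rightarrow> real \<Rightarrow> real"
    and a b :: real
  assumes "ergodic_system M \<sigma>"
    and "circle_generator M f"
    and "random_lift M f F"
    and "F \<in> integrable_End1 M"
    and "a \<le> b"
    and "{a..b} \<subseteq> {mean_rotation_number M \<sigma> (lower_map F)..mean_rotation_number M \<sigma> (upper_map F)}"
  shows "\<exists>\<Omega>\<^sub>I\<in>sets M. measure M \<Omega>\<^sub>I = 1 \<and>
    (AE \<omega>\<in>\<Omega>\<^sub>I in M. \<exists>x\<^sub>I::real. Clust (\<lambda>n. (cocycle \<sigma> F n \<omega> x\<^sub>I - x\<^sub>I) / real n) = {a..b})"
proof -
  interpret ergodic_system M \<sigma> by fact
  have F: "F \<in> M \<rightarrow>\<^sub>M uniform_borel End1_real" and int: "integrable M (\<lambda>\<omega>. sup_dist (F \<omega>) id)"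
    using assms(4) by (auto simp: integrable_End1_def)
  have End1: "F \<omega> \<in> End1_real" if "\<omega> \<in> space M" for \<omega>
    using measurable_space[OF F that] by (simp add: uniform_borel_space)
  note joint = random_map_joint_measurable[OF F]
  \<comment> \<open>The limit at the single base point 0 controls every starting point up to
    displacement 1, so one null set for each of the two maps suffices.\<close>
  have "AE \<omega> in M. (\<lambda>n. (cocycle \<sigma> (lower_map F) n \<omega> 0 - 0) / real n)
      \<longlonglongrightarrow> mean_rotation_number M \<sigma> (lower_map F)"
    by (rule AE_mean_rotation_number[OF _ lower_map_joint_measurable[OF joint End1] _ int])
      (auto intro: lower_map_mono_degree_one lower_map_displacement End1)
  moreover have "AE \<omega> in M. (\<lambda>n. (cocycle \<sigma> (upper_map F) n \<omega> 0 - 0) / real n)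
      \<longlonglongrightarrow> mean_rotation_number M \<sigma> (upper_map F)"
    by (rule AE_mean_rotation_number[OF _ upper_map_joint_measurable[OF joint End1] _ int])
      (auto intro: upper_map_mono_degree_one upper_map_displacement End1)
  ultimately have "AE \<omega> in M. \<exists>x. Clust (\<lambda>n. (cocycle \<sigma> F n \<omega> x - x) / real n) = {a..b}"
    using AE_space
  proof eventually_elim
    case (elim \<omega>)
    have E: "F ((\<sigma> ^^ k) \<omega>) \<in> End1_real" for k by (rule End1[OF shift_in_space[OF elim(3)]])
    then have cont: "continuous_on UNIV (F ((\<sigma> ^^ k) \<omega>))" for k by (simp add: End1_real_def)
    have "mean_rotation_number M \<sigma> (lower_map F) \<le> a" "b \<le> mean_rotation_number M \<sigma> (upper_map F)"
      using assms(5,6) by auto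
    with elim(1,2) assms(5) show ?case
      unfolding cocycle_eq_orbit diff_zero
      by (intro orbit_with_cluster_interval[OF cont])
        (auto intro: lower_map_mono_degree_one[of F, OF E] lower_map_contact[of F, OF E]
          lower_map_contact_closed[of F, OF E] upper_map_mono_degree_one[of F, OF E]
          upper_map_contact[of F, OF E] upper_map_contact_closed[of F, OF E])
  qed
  \<comment> \<open>The whole space serves as the full-measure set; the exceptional null set is left
    to the inner almost-everywhere quantifier.\<close>
  then show ?thesis
    by (intro bexI[of _ "space M"]) (auto simp: prob_space elim: AE_mp)
qed

end
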